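(* Let $\theta$ be a primitive aperiodic bijective substitution. Then the dynamical system $(X_\theta,\mathbb Z,\sigma)$ is semi-regular.
   Context: A substitution of constant length $\ell$ on a finite alphabet $\mathcal A$ is a map $\theta(a)=\theta_0(a)\cdots\theta_{\ell-1}(a)$ with maps $\theta_i:\mathcal A\to\mathcal A$, extended to words by concatenation. It is bijective if all $\theta_i$ are bijections, primitive if for some $k$ every $\theta^k(a)$ contains every letter. A word is allowed if it occurs in some $\theta^k(a)$; $X_\theta\subset\mathcal A^{\mathbb Z}$ is the space of bi-infinite sequences all of whose finite subwords are allowed, with left shift $\sigma$. $\theta$ is aperiodic if $X_\theta$ contains no $\sigma$-periodic sequence. For a minimal system $(X,T,\sigma)$ with $T$ abelian, let $E$ be its Ellis semigroup (closure of $\{\sigma^t:t\in T\}$ in $X^X$ for pointwise convergence, under composition), and $e\in E$ a minimal idempotent (minimal for $p\le q\iff p=pq=qp$). Then $\mathcal G=eEe$ is a group acting on $e(X)$. The virtual automorphism group $V(X)$ is the centraliser $C_{S_{e(X)}}(\mathcal G)$ of $\mathcal G$ in the group $S_{e(X)}$ of all permutations of $e(X)$ (independent of $e$ up to isomorphism). $\mathrm{Aut}(X)$ is the group of homeomorphisms of $X$ commuting with the action. The system is semi-regular if the restriction map $\mathrm{Aut}(X)\to V(X)$, $\Phi\mapsto\Phi|_{e(X)}$, is an isomorphism. *)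

theory Defs
  imports "HOL-Analysis.Analysis" "HOL-Algebra.Bij" "HOL-Library.Sublist"
begin

section \<open>Ellis semigroup and virtual automorphism group\<close>

text \<open>
  A system is a topology \<open>X\<close> (with phase space \<open>topspace X\<close>) together with an action
  \<open>\<alpha> :: 't \<Rightarrow> 'x \<Rightarrow> 'x\<close> of an abelian group \<open>'t\<close>, of which only the values on \<open>topspace X\<close>
  matter. Self-maps of a set \<open>S\<close> are represented by extensional functions (equal to
  \<^const>\<open>undefined\<close> outside \<open>S\<close>), as in \<^const>\<open>PiE\<close> and \<^const>\<open>BijGroup\<close>; composition is
  \<^term>\<open>compose S\<close>.
\<close>

text \<open>The product topology on \<open>X\<close> to the power \<open>X\<close> is the topology of pointwise convergence.\<close>

definition ellis_semigroup ::
    "'x topology \<Rightarrow> ('t::ab_group_add \<Rightarrow> 'x \<Rightarrow> 'x) \<Rightarrow> ('x \<Rightarrow> 'x) set" where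
  "ellis_semigroup X \<alpha> =
     product_topology (\<lambda>_. X) (topspace X) closure_of
       range (\<lambda>t. restrict (\<alpha> t) (topspace X))"

definition ellis_idempotent ::
    "'x topology \<Rightarrow> ('t::ab_group_add \<Rightarrow> 'x \<Rightarrow> 'x) \<Rightarrow> ('x \<Rightarrow> 'x) \<Rightarrow> bool" where
  "ellis_idempotent X \<alpha> p \<longleftrightarrow>
     p \<in> ellis_semigroup X \<alpha> \<and> compose (topspace X) p p = p"

definition minimal_idempotent ::
    "'x topology \<Rightarrow> ('t::ab_group_add \<Rightarrow> 'x \<Rightarrow> 'x) \<Rightarrow> ('x \<Rightarrow> 'x) \<Rightarrow> bool" where
  "minimal_idempotent X \<alpha> e \<longleftrightarrow>
     ellis_idempotent X \<alpha> e \<and>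
     (\<forall>p. ellis_idempotent X \<alpha> p \<and>
          p = compose (topspace X) p e \<and> p = compose (topspace X) e p \<longrightarrow> p = e)"

text \<open>\<open>\<G> = e E e\<close>\<close>

definition ellis_group ::
    "'x topology \<Rightarrow> ('t::ab_group_add \<Rightarrow> 'x \<Rightarrow> 'x) \<Rightarrow> ('x \<Rightarrow> 'x) \<Rightarrow> ('x \<Rightarrow> 'x) set" where
  "ellis_group X \<alpha> e =
     {compose (topspace X) e (compose (topspace X) f e) | f. f \<in> ellis_semigroup X \<alpha>}"

definition centraliser :: "('g, 'm) monoid_scheme \<Rightarrow> 'g set \<Rightarrow> 'g set" where
  "centraliser G H = {a \<in> carrier G. \<forall>h\<in>H. a \<otimes>\<^bsub>G\<^esub> h = h \<otimes>\<^bsub>G\<^esub> a}"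

text \<open>
  \<open>\<G>\<close> acts on \<open>e(X)\<close> by restriction, which makes it a set of permutations of \<open>e(X)\<close>.
\<close>

definition virtual_automorphism_group ::
    "'x topology \<Rightarrow> ('t::ab_group_add \<Rightarrow> 'x \<Rightarrow> 'x) \<Rightarrow> ('x \<Rightarrow> 'x) \<Rightarrow> ('x \<Rightarrow> 'x) monoid" where
  "virtual_automorphism_group X \<alpha> e =
     (let S = e ` topspace X in
      BijGroup S\<lparr>carrier :=
        centraliser (BijGroup S) ((\<lambda>g. restrict g S) ` ellis_group X \<alpha> e)\<rparr>)"

definition automorphism_group ::
    "'x topology \<Rightarrow> ('t::ab_group_add \<Rightarrow> 'x \<Rightarrow> 'x) \<Rightarrow> ('x \<Rightarrow> 'x) monoid" where
  "automorphism_group X \<alpha> =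
     BijGroup (topspace X)\<lparr>carrier :=
       {\<Phi> \<in> Bij (topspace X). homeomorphic_map X X \<Phi> \<and>
          (\<forall>t. \<forall>x\<in>topspace X. \<Phi> (\<alpha> t x) = \<alpha> t (\<Phi> x))}\<rparr>"

text \<open>
  The property does not depend on the choice of the minimal idempotent \<open>e\<close>, and a minimal
  idempotent exists whenever \<open>X\<close> is compact Hausdorff; we quantify over all of them.
\<close>

definition semi_regular ::
    "'x topology \<Rightarrow> ('t::ab_group_add \<Rightarrow> 'x \<Rightarrow> 'x) \<Rightarrow> bool" where
  "semi_regular X \<alpha> \<longleftrightarrow>
     (\<forall>e. minimal_idempotent X \<alpha> e \<longrightarrow>
        (\<lambda>\<Phi>. restrict \<Phi> (e ` topspace X))
          \<in> iso (automorphism_group X \<alpha>) (virtual_automorphism_group X \<alpha> e))"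


section \<open>Substitutions of constant length\<close>

text \<open>
  The alphabet is a type of class \<^class>\<open>finite\<close>; a substitution is given by its values on
  letters, and \<open>\<theta>\<^sub>i(a)\<close> is \<open>\<theta> a ! i\<close>.
\<close>

definition constant_length :: "nat \<Rightarrow> ('a \<Rightarrow> 'a list) \<Rightarrow> bool" where
  "constant_length L \<theta> \<longleftrightarrow> (\<forall>a. length (\<theta> a) = L)"

definition bijective_subst :: "nat \<Rightarrow> ('a \<Rightarrow> 'a list) \<Rightarrow> bool" where
  "bijective_subst L \<theta> \<longleftrightarrow> constant_length L \<theta> \<and> (\<forall>i<L. bij (\<lambda>a. \<theta> a ! i))"

definition subst_word :: "('a \<Rightarrow> 'a list) \<Rightarrow> 'a list \<Rightarrow> 'a list" where
  "subst_word \<theta> w = concat (map \<theta> w)"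

definition subst_iter :: "('a \<Rightarrow> 'a list) \<Rightarrow> nat \<Rightarrow> 'a \<Rightarrow> 'a list" where
  "subst_iter \<theta> k a = (subst_word \<theta> ^^ k) [a]"

definition primitive_subst :: "('a \<Rightarrow> 'a list) \<Rightarrow> bool" where
  "primitive_subst \<theta> \<longleftrightarrow> (\<exists>k. \<forall>a. set (subst_iter \<theta> k a) = UNIV)"

definition allowed_word :: "('a \<Rightarrow> 'a list) \<Rightarrow> 'a list \<Rightarrow> bool" where
  "allowed_word \<theta> w \<longleftrightarrow> (\<exists>k a. sublist w (subst_iter \<theta> k a))"

definition subst_shift_space :: "('a \<Rightarrow> 'a list) \<Rightarrow> (int \<Rightarrow> 'a) set" where
  "subst_shift_space \<theta> = {x. \<forall>m n. allowed_word \<theta> (map x [m..n])}"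

definition subst_topology :: "('a \<Rightarrow> 'a list) \<Rightarrow> (int \<Rightarrow> 'a) topology" where
  "subst_topology \<theta> =
     subtopology (product_topology (\<lambda>_. discrete_topology UNIV) UNIV) (subst_shift_space \<theta>)"

text \<open>\<open>shift n\<close> is the \<open>n\<close>-th power of the left shift \<open>\<sigma>\<close>.\<close>

definition shift :: "int \<Rightarrow> (int \<Rightarrow> 'a) \<Rightarrow> int \<Rightarrow> 'a" where
  "shift n x = (\<lambda>k. x (k + n))"

definition aperiodic_subst :: "('a \<Rightarrow> 'a list) \<Rightarrow> bool" where
  "aperiodic_subst \<theta> \<longleftrightarrow> (\<nexists>x p. x \<in> subst_shift_space \<theta> \<and> p > 0 \<and> shift p x = x)"

end

theory Submission
  imports Defs
begin

text \<open>
  Let \<open>f\<close> be in the centraliser of \<open>\<G>\<close>, \<open>x\<close> in \<open>e(X)\<close> and \<open>y = f(x)\<close>. If \<open>p(x) = q(x)\<close> with \<open>p, q \<in> E\<close>,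
  then, as \<open>e s p e\<close> and \<open>e s q e\<close> lie in \<open>\<G>\<close>, also \<open>e(s(p(y))) = e(s(q(y)))\<close> for every \<open>s \<in> E\<close>.
  If the maps \<open>e s\<close> separate the points of \<open>X\<close>, this gives \<open>p(y) = q(y)\<close>, so \<open>p(x) \<mapsto> p(y)\<close> is a
  well defined automorphism of \<open>X\<close> extending \<open>f\<close>.

  For a bijective substitution the separation comes from two observations on points \<open>v \<noteq> w\<close>
  desubstituted at all levels \<open>\<theta>\<^sup>k\<close>. If \<open>v\<close> and \<open>w\<close> have different residues modulo \<open>L\<^sup>k\<close> for some \<open>k\<close>,
  then on a window where they agree the letters of a desubstitution are obtained from one another
  by iterating one fixed map, so long windows of agreement would produce a periodic point. If all
  residues agree, then, once \<open>v\<close> and \<open>w\<close> differ at one position, bijectivity makes them differ on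
  the whole block containing it, hence on a half-line. In either case some limit \<open>s\<close> of shifts makes \<open>s(v)\<close>
  and \<open>s(w)\<close> differ within every window of a fixed length, and this survives all further limits.
\<close>

section \<open>Compact flows\<close>

locale compact_flow =
  fixes X :: "'x topology" and \<alpha> :: "'t::ab_group_add \<Rightarrow> 'x \<Rightarrow> 'x"
  assumes compact: "compact_space X"
    and Hausdorff: "Hausdorff_space X"
    and action_continuous: "continuous_map X X (\<alpha> t)"
    and action_zero: "x \<in> topspace X \<Longrightarrow> \<alpha> 0 x = x"
    and action_add: "x \<in> topspace X \<Longrightarrow> \<alpha> (s + t) x = \<alpha> s (\<alpha> t x)"
begin

abbreviation S where "S \<equiv> topspace X"
abbreviation E where "E \<equiv> ellis_semigroup X \<alpha>"
abbreviation T where "T \<equiv> product_topology (\<lambda>_. X) S"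
abbreviation act where "act t \<equiv> restrict (\<alpha> t) S"

section \<open>Closure and composition in the Ellis semigroup\<close>

lemma action_closed: "x \<in> S \<Longrightarrow> \<alpha> t x \<in> S"
  using action_continuous[of t] by (auto simp: continuous_map_def)

lemma act_in_topspace: "act t \<in> topspace T"
  by (auto simp: action_closed)

lemma act_in_ellis: "act t \<in> E"
  unfolding ellis_semigroup_def using closure_of_subset[of "range act" T] act_in_topspace by blast

lemma closedin_ellis: "closedin T E"
  unfolding ellis_semigroup_def by simp

lemma ellis_subset: "E \<subseteq> topspace T"
  using closedin_ellis closedin_subset by blast

lemma ellis_closed: "p \<in> E \<Longrightarrow> x \<in> S \<Longrightarrow> p x \<in> S"
  using ellis_subset by (auto simp: PiE_iff)

lemma compact_T: "compact_space T"
  by (simp add: compact_space_product_topology compact)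

lemma Hausdorff_T: "Hausdorff_space T"
  by (simp add: Hausdorff_space_product_topology Hausdorff)

lemma continuous_eval: "x \<in> S \<Longrightarrow> continuous_map T X (\<lambda>p. p x)"
  by (rule continuous_map_product_projection)

text \<open>Conditions closed in \<open>p\<close> pass from translations to all of \<open>E\<close>;
  this replaces arguments with nets.\<close>

lemma ellis_induct:
  assumes "p \<in> E" "\<And>t. P (act t)" "closedin T {p \<in> topspace T. P p}"
  shows "P p"
  using forall_in_closure_of[of p T "range act" P] assms unfolding ellis_semigroup_def by blast

text \<open>The coordinates are evaluations at \<open>q x\<close>, so \<open>q\<close> may be
  discontinuous. In \<open>continuous_postcompose\<close> the fixed factor has to be continuous
  itself.\<close>

lemma continuous_precompose:
  assumes "q \<in> topspace T"
  shows "continuous_map T T (\<lambda>p. compose S p q)"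
  unfolding continuous_map_componentwise
proof (intro conjI ballI)
  show "(\<lambda>p. compose S p q) ` topspace T \<subseteq> extensional S"
    by (auto simp: compose_def)
  fix x assume x: "x \<in> S"
  with assms have "q x \<in> S" by (auto simp: PiE_iff)
  with continuous_eval show "continuous_map T X (\<lambda>p. compose S p q x)"
    using x by (simp add: compose_def)
qed

lemma continuous_postcompose:
  assumes "continuous_map X X f"
  shows "continuous_map T T (compose S f)"
  unfolding continuous_map_componentwise
proof (intro conjI ballI)
  show "compose S f ` topspace T \<subseteq> extensional S"
    by (auto simp: compose_def)
  fix x assume x: "x \<in> S"
  with continuous_map_compose[OF continuous_eval[OF x] assms]
  show "continuous_map T X (\<lambda>p. compose S f p x)"
    by (simp add: compose_def comp_def)
qed

text \<open>First half of closure under composition: translations are continuous, so the right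
  factor may pass to the limit. \<open>ellis_compose\<close> then passes to the limit on the left
  with the right factor fixed.\<close>

lemma act_compose_ellis:
  assumes "p \<in> E"
  shows "compose S (act t) p \<in> E"
  using assms
proof (rule ellis_induct)
  show "compose S (act t) (act s) \<in> E" for s
  proof -
    have "compose S (act t) (act s) = act (t + s)"
      by (auto simp: compose_def action_closed action_add)
    then show ?thesis using act_in_ellis by simp
  qed
  have "continuous_map X X (act t)"
    using action_continuous[of t] continuous_map_eq by fastforce
  then show "closedin T {p \<in> topspace T. compose S (act t) p \<in> E}"
    by (intro closedin_continuous_map_preimage[OF continuous_postcompose closedin_ellis])
qed

lemma ellis_compose:
  assumes "p \<in> E" "q \<in> E"
  shows "compose S p q \<in> E"
  using assms(1)
proof (rule ellis_induct)
  show "compose S (act t) q \<in> E" for t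
    using act_compose_ellis[OF assms(2)] .
  show "closedin T {p \<in> topspace T. compose S p q \<in> E}"
    using assms(2) ellis_subset
    by (intro closedin_continuous_map_preimage[OF continuous_precompose closedin_ellis]) auto
qed

text \<open>Both sides are continuous in \<open>p\<close> and agree on translations; the Hausdorff
  property carries the equality to the closure.\<close>

lemma equivariant_commutes_ellis:
  assumes "continuous_map X X \<Phi>" "\<And>t x. x \<in> S \<Longrightarrow> \<Phi> (\<alpha> t x) = \<alpha> t (\<Phi> x)" "p \<in> E" "x \<in> S"
  shows "\<Phi> (p x) = p (\<Phi> x)"
proof (rule forall_in_closure_of_eq[of p T "range act" X "\<lambda>p. \<Phi> (p x)" "\<lambda>p. p (\<Phi> x)"])
  have \<Phi>x: "\<Phi> x \<in> S" using assms by (auto simp: continuous_map_def)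
  show "p \<in> T closure_of range act" using assms(3) by (simp add: ellis_semigroup_def)
  show "continuous_map T X (\<lambda>p. \<Phi> (p x))"
    using continuous_map_compose[OF continuous_eval[OF assms(4)] assms(1)] by (simp add: comp_def)
  show "continuous_map T X (\<lambda>p. p (\<Phi> x))" using continuous_eval[OF \<Phi>x] .
  show "\<Phi> (q x) = q (\<Phi> x)" if "q \<in> range act" for q
    using that assms \<Phi>x by auto
qed (rule Hausdorff)

text \<open>The Ellis--Numakura lemma.\<close>

lemma exists_idempotent:
  assumes C: "closedin T C" "C \<noteq> {}" and mult: "\<And>p q. p \<in> C \<Longrightarrow> q \<in> C \<Longrightarrow> compose S p q \<in> C"
  shows "\<exists>i\<in>C. compose S i i = i"
proof -
  \<comment> \<open>The closed nonempty subsemigroups of \<open>C\<close>. Zorn under reverse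
    inclusion yields a minimal one, whose elements turn out to be idempotent.\<close>
  define \<A> where "\<A> = {M. M \<subseteq> C \<and> closedin T M \<and> M \<noteq> {} \<and> (\<forall>p\<in>M. \<forall>q\<in>M. compose S p q \<in> M)}"
  have "\<exists>M\<in>\<A>. \<forall>N\<in>\<A>. N \<subseteq> M \<longrightarrow> N = M"
  proof (rule predicate_Zorn)
    show "partial_order_on \<A> (relation_of (\<lambda>M N. N \<subseteq> M) \<A>)"
      by (rule partial_order_on_relation_ofI) auto
    fix \<C> assume "\<C> \<in> Chains (relation_of (\<lambda>M N. N \<subseteq> M) \<A>)"
    then have sub: "\<C> \<subseteq> \<A>" and chain: "\<And>M N. M \<in> \<C> \<Longrightarrow> N \<in> \<C> \<Longrightarrow> M \<subseteq> N \<or> N \<subseteq> M"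
      by (auto simp: Chains_def relation_of_def)
    show "\<exists>U\<in>\<A>. \<forall>M\<in>\<C>. U \<subseteq> M"
    proof (cases "\<C> = {}")
      case True
      then show ?thesis using C mult by (auto simp: \<A>_def)
    next
      case False
      \<comment> \<open>A finite subfamily of a chain has a least member; this gives the finite
        intersection property.\<close>
      have min: "\<exists>M\<in>\<F>. \<Inter>\<F> = M" if "finite \<F>" "\<F> \<noteq> {}" "\<F> \<subseteq> \<C>" for \<F>
        using that
      proof (induction \<F> rule: finite_ne_induct)
        case (insert M \<F>)
        then obtain N where N: "N \<in> \<F>" "\<Inter>\<F> = N" by auto
        with insert.prems have "M \<subseteq> N \<or> N \<subseteq> M" by (intro chain) auto
        moreover have "\<Inter>(insert M \<F>) = M \<inter> N" using N by simp
        ultimately show ?case using N(1) by (metis inf.absorb1 inf.absorb2 insertCI)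
      qed auto
      have "\<Inter>\<C> \<noteq> {}"
      proof (rule compact_T[unfolded compact_space_fip, rule_format], intro conjI ballI allI impI)
        show "closedin T M" if "M \<in> \<C>" for M using that sub by (auto simp: \<A>_def)
        fix \<F> assume F: "finite \<F> \<and> \<F> \<subseteq> \<C>"
        show "\<Inter>\<F> \<noteq> {}"
        proof (cases "\<F> = {}")
          case False
          with F min obtain M where "M \<in> \<F>" "\<Inter>\<F> = M" by metis
          with F sub have "\<Inter>\<F> \<in> \<A>" by auto
          then show ?thesis by (simp add: \<A>_def)
        qed auto
      qed
      moreover have "closedin T (\<Inter>\<C>)"
        using False sub by (intro closedin_Inter) (auto simp: \<A>_def)
      moreover have "\<Inter>\<C> \<subseteq> C"
      proof -
        obtain M where "M \<in> \<C>" using False by blast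
        with sub show ?thesis unfolding \<A>_def by blast
      qed
      moreover have "\<forall>p\<in>\<Inter>\<C>. \<forall>q\<in>\<Inter>\<C>. compose S p q \<in> \<Inter>\<C>" using sub by (auto simp: \<A>_def)
      ultimately have "\<Inter>\<C> \<in> \<A>" by (simp add: \<A>_def)
      then show ?thesis by blast
    qed
  qed
  then obtain M where M: "M \<in> \<A>" and minimal: "\<And>N. N \<in> \<A> \<Longrightarrow> N \<subseteq> M \<Longrightarrow> N = M" by blast
  from M obtain q where q: "q \<in> M" by (auto simp: \<A>_def)
  have MC: "M \<subseteq> C" and clM: "closedin T M"
    and mulM: "\<And>p q. p \<in> M \<Longrightarrow> q \<in> M \<Longrightarrow> compose S p q \<in> M"
    using M by (simp_all add: \<A>_def)
  have top: "M \<subseteq> topspace T" using clM by (rule closedin_subset)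
  have fs: "p \<in> S \<rightarrow> S" if "p \<in> M" for p using that top by (auto simp: PiE_iff)
  have assoc: "compose S (compose S a b) c = compose S a (compose S b c)" if "c \<in> M" for a b c
    using compose_assoc[OF fs[OF that]] by metis
  have cont: "continuous_map T T (\<lambda>p. compose S p q)"
    using q top by (intro continuous_precompose) auto
  \<comment> \<open>The right translate of \<open>M\<close> by \<open>q\<close> is a closed
    subsemigroup inside \<open>M\<close>, so it is \<open>M\<close> and contains
    \<open>q\<close>.\<close>
  have "(\<lambda>p. compose S p q) ` M = M"
  proof (rule minimal)
    show "(\<lambda>p. compose S p q) ` M \<subseteq> M" using mulM q by auto
    have "compactin T ((\<lambda>p. compose S p q) ` M)"
      using image_compactin[OF closedin_compact_space[OF compact_T clM] cont] .
    then have "closedin T ((\<lambda>p. compose S p q) ` M)"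
      using compactin_imp_closedin Hausdorff_T by blast
    moreover have "compose S x y \<in> (\<lambda>p. compose S p q) ` M"
      if "x \<in> (\<lambda>p. compose S p q) ` M" "y \<in> (\<lambda>p. compose S p q) ` M" for x y
    proof -
      from that obtain a b where ab: "a \<in> M" "x = compose S a q" "b \<in> M" "y = compose S b q" by auto
      then have "compose S x y = compose S (compose S (compose S a q) b) q"
        using assoc[OF q, of "compose S a q" b] by simp
      then show ?thesis using ab q mulM by blast
    qed
    ultimately show "(\<lambda>p. compose S p q) ` M \<in> \<A>"
      using q mulM MC by (auto simp: \<A>_def)
  qed
  with q have "q \<in> (\<lambda>p. compose S p q) ` M" by simp
  then obtain p where p: "p \<in> M" "compose S p q = q" by (metis imageE)
  \<comment> \<open>The elements of \<open>M\<close> fixing \<open>q\<close> from the left form a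
    closed subsemigroup, nonempty because of \<open>p\<close>; by minimality it contains
    \<open>q\<close>.\<close>
  have "{p \<in> M. compose S p q = q} = M"
  proof (rule minimal)
    have "closedin T {q}"
      using closedin_Hausdorff_singleton[OF Hausdorff_T subsetD[OF top q]] .
    from closedin_Int[OF clM closedin_continuous_map_preimage[OF cont this]]
    have "closedin T (M \<inter> {p \<in> topspace T. compose S p q \<in> {q}})" .
    moreover have "M \<inter> {p \<in> topspace T. compose S p q \<in> {q}} = {p \<in> M. compose S p q = q}"
      using top by blast
    ultimately have "closedin T {p \<in> M. compose S p q = q}" by simp
    moreover have "compose S (compose S a b) q = q"
      if "compose S a q = q" "compose S b q = q" for a b
      using that assoc[OF q, of a b] by simp
    ultimately show "{p \<in> M. compose S p q = q} \<in> \<A>"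
      using p mulM MC by (auto simp: \<A>_def)
  qed blast
  then have "compose S q q = q" using q by blast
  with q MC show ?thesis by blast
qed


lemma ellis_assoc:
  "c \<in> E \<Longrightarrow> compose S (compose S a b) c = compose S a (compose S b c)"
  by (rule compose_assoc[of c S S a b, symmetric]) (auto simp: ellis_closed)

text \<open>The image of the compact set \<open>E\<close> under evaluation at \<open>x\<close> is
  closed and contains the dense orbit of \<open>x\<close>.\<close>

lemma ellis_orbit:
  assumes dense: "S \<subseteq> X closure_of range (\<lambda>t. \<alpha> t x)" and x: "x \<in> S"
  shows "(\<lambda>p. p x) ` E = S"
proof
  show "(\<lambda>p. p x) ` E \<subseteq> S" using ellis_closed x by auto
  have "compactin X ((\<lambda>p. p x) ` E)"
    using image_compactin[OF closedin_compact_space[OF compact_T closedin_ellis] continuous_eval[OF x]] .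
  then have "closedin X ((\<lambda>p. p x) ` E)"
    using compactin_imp_closedin Hausdorff by blast
  moreover have "\<alpha> t x \<in> (\<lambda>p. p x) ` E" for t
    using act_in_ellis[of t] x by (intro image_eqI[of _ _ "act t"]) auto
  ultimately show "S \<subseteq> (\<lambda>p. p x) ` E"
    using dense closure_of_minimal[of "range (\<lambda>t. \<alpha> t x)" "(\<lambda>p. p x) ` E" X] by blast
qed

section \<open>The group attached to a minimal idempotent, acting on the image of
  \<open>e\<close>\<close>

context
  fixes e
  assumes e: "minimal_idempotent X \<alpha> e"
begin

lemma e_ellis: "e \<in> E"
  using e by (simp add: minimal_idempotent_def ellis_idempotent_def)

lemma e_idem: "compose S e e = e"
  using e by (simp add: minimal_idempotent_def ellis_idempotent_def)

lemma e_fixes: "x \<in> e ` S \<Longrightarrow> e x = x"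
  using e_idem by (metis compose_eq imageE)

lemma e_image: "e ` S \<subseteq> S"
  using e_ellis ellis_closed by blast

lemma ellis_group_ellis: "g \<in> ellis_group X \<alpha> e \<Longrightarrow> g \<in> E"
  unfolding ellis_group_def using e_ellis ellis_compose by blast

lemma ellis_group_left_inverse:
  assumes g: "g \<in> ellis_group X \<alpha> e"
  shows "\<exists>k\<in>ellis_group X \<alpha> e. \<forall>x\<in>e ` S. k (g x) = x"
proof -
  have gE: "g \<in> E" using g by (rule ellis_group_ellis)
  from g obtain f where "f \<in> E" "g = compose S e (compose S f e)"
    by (auto simp: ellis_group_def)
  then have ge: "compose S g e = g" and eg: "compose S e g = g"
    using e_ellis e_idem ellis_compose by (metis ellis_assoc)+
  \<comment> \<open>The left ideal \<open>E g\<close> contains an idempotent \<open>i\<close>; then \<open>e i\<close> is an idempotent below \<open>e\<close>, so \<open>e = e i \<in> E g\<close>.\<close>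
  let ?C = "(\<lambda>q. compose S q g) ` E"
  have "\<exists>i\<in>?C. compose S i i = i"
  proof (rule exists_idempotent)
    show "closedin T ?C"
      using gE ellis_subset Hausdorff_T
      by (intro compactin_imp_closedin image_compactin[OF closedin_compact_space[OF compact_T closedin_ellis]]
          continuous_precompose) auto
    show "?C \<noteq> {}" using gE by auto
    fix p q assume "p \<in> ?C" "q \<in> ?C"
    then obtain a b where ab: "a \<in> E" "p = compose S a g" "b \<in> E" "q = compose S b g" by auto
    then have "compose S p q = compose S (compose S (compose S a g) b) g"
      using ellis_assoc[OF gE, of "compose S a g" b] by simp
    then show "compose S p q \<in> ?C" using ab gE ellis_compose by blast
  qed
  then obtain q where q: "q \<in> E" and i: "compose S (compose S q g) (compose S q g) = compose S q g"
    by auto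
  define i where "i = compose S q g"
  have iE: "i \<in> E" and ii: "compose S i i = i" and ie: "compose S i e = i"
    using i q gE ellis_compose ge ellis_assoc[OF e_ellis, of q g] by (auto simp: i_def)
  define p where "p = compose S e i"
  have pE: "p \<in> E" using e_ellis iE ellis_compose by (simp add: p_def)
  have "compose S p p = p" "p = compose S p e" "p = compose S e p"
    unfolding p_def using ii ie e_idem ellis_assoc e_ellis iE ellis_compose by metis+
  with e pE have "p = e"
    by (simp add: minimal_idempotent_def ellis_idempotent_def)
  \<comment> \<open>Inserting \<open>e\<close> between \<open>q\<close> and \<open>g\<close> changes
    nothing, by \<open>eg\<close>, and brings the left inverse into
    \<open>ellis_group X \<alpha> e\<close>.\<close>
  define k where "k = compose S e (compose S q e)"
  have "compose S k g = e"
  proof -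
    have "compose S k g = compose S e (compose S q (compose S e g))"
      using ellis_assoc[OF gE, of e "compose S q e"] ellis_assoc[OF gE, of q e] by (simp add: k_def)
    then show ?thesis using eg \<open>p = e\<close> by (simp add: p_def i_def)
  qed
  then have "k (g x) = x" if "x \<in> e ` S" for x
    using that e_fixes e_image by (metis compose_eq subsetD)
  moreover have "k \<in> ellis_group X \<alpha> e" using q by (auto simp: k_def ellis_group_def)
  ultimately show ?thesis by blast
qed

lemma ellis_group_image: "g \<in> ellis_group X \<alpha> e \<Longrightarrow> x \<in> S \<Longrightarrow> g x \<in> e ` S"
  using e_ellis ellis_closed by (auto simp: ellis_group_def compose_eq)

lemma ellis_group_inj:
  assumes "g \<in> ellis_group X \<alpha> e"
  shows "inj_on g (e ` S)"
  using ellis_group_left_inverse[OF assms] by (metis inj_onI)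

lemma ellis_group_Bij:
  assumes g: "g \<in> ellis_group X \<alpha> e"
  shows "restrict g (e ` S) \<in> Bij (e ` S)"
proof -
  obtain k where k: "k \<in> ellis_group X \<alpha> e" "\<And>x. x \<in> e ` S \<Longrightarrow> k (g x) = x"
    using ellis_group_left_inverse[OF g] by blast
  have img: "h x \<in> e ` S" if "h \<in> ellis_group X \<alpha> e" "x \<in> e ` S" for h x
    using that ellis_group_image e_image by blast
  have "y \<in> g ` (e ` S)" if y: "y \<in> e ` S" for y
  proof -
    \<comment> \<open>Surjectivity of \<open>g\<close> comes from injectivity of \<open>k\<close>,
      which lies in the group too.\<close>
    have "k (g (k y)) = k y" using k img y by blast
    then have "g (k y) = y"
      using ellis_group_inj[OF k(1)] img k(1) g y by (meson inj_onD)
    then show ?thesis using img k(1) y by (metis image_eqI)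
  qed
  then have "bij_betw g (e ` S) (e ` S)"
    using ellis_group_inj[OF g] img[OF g] by (auto simp: bij_betw_def)
  then show ?thesis by (simp add: Bij_def)
qed

text \<open>
  The multiplication of \<^const>\<open>BijGroup\<close> is junk outside \<^const>\<open>Bij\<close>, so it matters here that \<open>\<G>\<close> acts by
  permutations, which needs \<open>e\<close> to be minimal.
\<close>

lemma virtual_automorphism_iff:
  "h \<in> carrier (virtual_automorphism_group X \<alpha> e) \<longleftrightarrow>
     h \<in> Bij (e ` S) \<and> (\<forall>g\<in>ellis_group X \<alpha> e. \<forall>x\<in>e ` S. h (g x) = g (h x))"
proof (cases "h \<in> Bij (e ` S)")
  case True
  have img: "g x \<in> e ` S" if "g \<in> ellis_group X \<alpha> e" "x \<in> e ` S" for g x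
    using that ellis_group_image e_image by blast
  have h: "h x \<in> e ` S" if "x \<in> e ` S" for x
    using True that Bij_imp_funcset by blast
  have "h \<otimes>\<^bsub>BijGroup (e ` S)\<^esub> restrict g (e ` S) = restrict g (e ` S) \<otimes>\<^bsub>BijGroup (e ` S)\<^esub> h
     \<longleftrightarrow> (\<forall>x\<in>e ` S. h (g x) = g (h x))" if g: "g \<in> ellis_group X \<alpha> e" for g
  proof -
    have "compose (e ` S) h (restrict g (e ` S)) = compose (e ` S) (restrict g (e ` S)) h
       \<longleftrightarrow> (\<forall>x\<in>e ` S. compose (e ` S) h (restrict g (e ` S)) x = compose (e ` S) (restrict g (e ` S)) h x)"
      by (metis compose_extensional extensionalityI)
    also have "\<dots> \<longleftrightarrow> (\<forall>x\<in>e ` S. h (g x) = g (h x))"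
      using h by (intro ball_cong refl) (simp add: compose_eq)
    finally show ?thesis
      using True ellis_group_Bij[OF g] by (simp add: BijGroup_def)
  qed
  with True show ?thesis
    by (simp add: virtual_automorphism_group_def Let_def centraliser_def BijGroup_def)
qed (simp add: virtual_automorphism_group_def Let_def centraliser_def BijGroup_def)

end

section \<open>Automorphisms and their restriction to the image of \<open>e\<close>\<close>

lemma automorphism_iff:
  "\<Phi> \<in> carrier (automorphism_group X \<alpha>) \<longleftrightarrow>
     \<Phi> \<in> Bij S \<and> homeomorphic_map X X \<Phi> \<and> (\<forall>t. \<forall>x\<in>S. \<Phi> (\<alpha> t x) = \<alpha> t (\<Phi> x))"
  by (simp add: automorphism_group_def)

lemma automorphism_commutes:
  assumes "\<Phi> \<in> carrier (automorphism_group X \<alpha>)" "p \<in> E" "x \<in> S"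
  shows "\<Phi> (p x) = p (\<Phi> x)"
  using assms equivariant_commutes_ellis homeomorphic_imp_continuous_map
  by (metis automorphism_iff)

text \<open>\<open>\<Phi>\<close> commutes with all of \<open>E\<close>: with \<open>e\<close>, so
  it maps the image of \<open>e\<close> onto itself, and with
  \<open>ellis_group X \<alpha> e\<close>, so it centralises.\<close>

lemma automorphism_restrict:
  assumes e: "minimal_idempotent X \<alpha> e" and \<Phi>: "\<Phi> \<in> carrier (automorphism_group X \<alpha>)"
  shows "restrict \<Phi> (e ` S) \<in> carrier (virtual_automorphism_group X \<alpha> e)"
proof -
  have \<Phi>S: "\<Phi> \<in> Bij S" using \<Phi> by (simp add: automorphism_iff)
  then have bij: "inj_on \<Phi> S" "\<Phi> ` S = S" by (auto simp: Bij_def bij_betw_def)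
  have "\<Phi> ` (e ` S) = e ` (\<Phi> ` S)"
    using automorphism_commutes[OF \<Phi> e_ellis[OF e]] by (auto simp: image_image cong: image_cong)
  then have img: "\<Phi> ` (e ` S) = e ` S" using bij by simp
  then have "bij_betw \<Phi> (e ` S) (e ` S)"
    using bij e_image[OF e] by (auto simp: bij_betw_def intro: inj_on_subset)
  moreover have "\<Phi> (g x) = g (\<Phi> x)" if "g \<in> ellis_group X \<alpha> e" "x \<in> e ` S" for g x
    using that automorphism_commutes[OF \<Phi>] ellis_group_ellis[OF e] e_image[OF e] by blast
  moreover have "g x \<in> e ` S" if "g \<in> ellis_group X \<alpha> e" "x \<in> e ` S" for g x
    using that ellis_group_image[OF e] e_image[OF e] by blast
  ultimately show ?thesis
    by (auto simp: virtual_automorphism_iff[OF e] Bij_def)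
qed

text \<open>As one \<open>s\<close> serves all \<open>p\<close>, the second assumption applies at
  \<open>p = e\<close> for whichever minimal idempotent \<open>e\<close> is given.\<close>

theorem semi_regularI:
  assumes dense: "\<And>x. x \<in> S \<Longrightarrow> S \<subseteq> X closure_of range (\<lambda>t. \<alpha> t x)"
    and separates: "\<And>v w. v \<in> S \<Longrightarrow> w \<in> S \<Longrightarrow> v \<noteq> w \<Longrightarrow> \<exists>s\<in>E. \<forall>p\<in>E. p (s v) \<noteq> p (s w)"
  shows "semi_regular X \<alpha>"
  unfolding semi_regular_def
proof (intro allI impI)
  fix e assume e: "minimal_idempotent X \<alpha> e"
  let ?A = "automorphism_group X \<alpha>" and ?V = "virtual_automorphism_group X \<alpha> e"
  let ?R = "\<lambda>\<Phi>. restrict \<Phi> (e ` S)"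
  note eE = e_ellis[OF e] and eS = e_image[OF e] and efix = e_fixes[OF e]
  have orbit: "\<exists>p\<in>E. y = p x" if "x \<in> S" "y \<in> S" for x y
    using ellis_orbit[OF dense[OF that(1)] that(1)] that(2) by auto
  have hom: "?R \<in> hom ?A ?V"
  proof (rule homI)
    fix \<Phi> assume "\<Phi> \<in> carrier ?A"
    with e show "?R \<Phi> \<in> carrier ?V" by (rule automorphism_restrict)
  next
    fix \<Phi> \<Psi> assume \<Phi>: "\<Phi> \<in> carrier ?A" and \<Psi>: "\<Psi> \<in> carrier ?A"
    have B: "\<Phi> \<in> Bij S" "\<Psi> \<in> Bij S" "?R \<Phi> \<in> Bij (e ` S)" "?R \<Psi> \<in> Bij (e ` S)"
      using \<Phi> \<Psi> automorphism_restrict[OF e] by (auto simp: automorphism_iff virtual_automorphism_iff[OF e])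
    have "\<Psi> x \<in> e ` S" if "x \<in> e ` S" for x
      using Bij_imp_funcset[OF B(4)] that by (auto simp: Pi_iff)
    then have "?R (compose S \<Phi> \<Psi>) = compose (e ` S) (?R \<Phi>) (?R \<Psi>)"
      using eS by (auto simp: fun_eq_iff compose_def restrict_def)
    then show "?R (\<Phi> \<otimes>\<^bsub>?A\<^esub> \<Psi>) = ?R \<Phi> \<otimes>\<^bsub>?V\<^esub> ?R \<Psi>"
      using B by (simp add: automorphism_group_def virtual_automorphism_group_def Let_def BijGroup_def)
  qed
  \<comment> \<open>An automorphism is determined by its value at \<open>e y\<close>, since it
    commutes with a \<open>p\<close> that moves \<open>e y\<close> to \<open>y\<close>.\<close>
  have inj: "inj_on ?R (carrier ?A)"
  proof (rule inj_onI)
    fix \<Phi> \<Psi> assume \<Phi>: "\<Phi> \<in> carrier ?A" and \<Psi>: "\<Psi> \<in> carrier ?A" and eq: "?R \<Phi> = ?R \<Psi>"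
    have "\<Phi> y = \<Psi> y" if y: "y \<in> S" for y
    proof -
      have ey: "e y \<in> e ` S" "e y \<in> S" using y eS by auto
      obtain p where p: "p \<in> E" "y = p (e y)" using orbit ey y by blast
      have "\<Phi> (e y) = \<Psi> (e y)" using eq ey by (metis restrict_apply')
      then show ?thesis
        using automorphism_commutes[OF \<Phi> p(1) ey(2)] automorphism_commutes[OF \<Psi> p(1) ey(2)] p(2) by metis
    qed
    then show "\<Phi> = \<Psi>"
      using \<Phi> \<Psi> by (auto simp: automorphism_iff Bij_def intro: extensionalityI)
  qed
  have "\<exists>\<Phi>\<in>carrier ?A. h = ?R \<Phi>" if h: "h \<in> carrier ?V" for h
  proof (cases "S = {}")
    case True
    then have "h \<in> Bij {}" using h by (simp only: virtual_automorphism_iff[OF e] image_empty)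
    moreover from this have "homeomorphic_map X X h"
      using True by (intro continuous_imp_homeomorphic_map[OF _ compact Hausdorff]) (auto simp: Bij_def)
    ultimately have "h \<in> carrier ?A" "h = ?R h"
      unfolding automorphism_iff True image_empty by (auto simp: Bij_def restrict_def extensional_def)
    then show ?thesis by blast
  next
    case False
    then obtain x0 where x0: "x0 \<in> e ` S" by blast
    have hB: "h \<in> Bij (e ` S)" and hg: "\<And>g x. g \<in> ellis_group X \<alpha> e \<Longrightarrow> x \<in> e ` S \<Longrightarrow> h (g x) = g (h x)"
      using h by (auto simp: virtual_automorphism_iff[OF e])
    have hinj: "inj_on h (e ` S)" and himg: "\<And>x. x \<in> e ` S \<Longrightarrow> h x \<in> e ` S"
      using hB by (auto simp: Bij_def bij_betw_def)
    define y0 where "y0 = h x0"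
    have y0: "y0 \<in> e ` S" using himg x0 by (simp add: y0_def)
    have x0S: "x0 \<in> S" and y0S: "y0 \<in> S" using x0 y0 eS by auto
    \<comment> \<open>\<open>h\<close> commutes with \<open>compose S e (compose S p e)\<close>, and
      \<open>e\<close> fixes both \<open>x0\<close> and \<open>y0\<close>.\<close>
    have transfer: "h (e (p x0)) = e (p y0)" if "p \<in> E" for p
    proof -
      have "compose S e (compose S p e) \<in> ellis_group X \<alpha> e" using that by (auto simp: ellis_group_def)
      from hg[OF this x0] show ?thesis
        using x0S y0S efix[OF x0] efix[OF y0] by (simp add: compose_eq flip: y0_def)
    qed
    \<comment> \<open>Left to right makes \<open>p x0 \<mapsto> p y0\<close> well defined, right to
      left makes it injective. Both directions separate points by the maps \<open>e\<close> after
      \<open>s\<close>; the second also cancels \<open>h\<close>.\<close>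
    have iff: "p x0 = q x0 \<longleftrightarrow> p y0 = q y0" if p: "p \<in> E" and q: "q \<in> E" for p q
    proof -
      have pq: "p z \<in> S" "q z \<in> S" if "z \<in> S" for z using that p q ellis_closed by auto
      have sp: "h (e (s (p x0))) = e (s (p y0))" "h (e (s (q x0))) = e (s (q y0))" if "s \<in> E" for s
        using transfer[of "compose S s p"] transfer[of "compose S s q"] that p q ellis_compose x0S y0S
        by (auto simp: compose_eq)
      show ?thesis
      proof
        assume "p x0 = q x0"
        then have "e (s (p y0)) = e (s (q y0))" if "s \<in> E" for s using sp[OF that] by simp
        then show "p y0 = q y0" using separates[of "p y0" "q y0"] pq y0S eE by metis
      next
        assume "p y0 = q y0"
        then have "e (s (p x0)) = e (s (q x0))" if "s \<in> E" for s
          using sp[OF that] hinj pq[OF x0S] ellis_closed[OF that] by (metis imageI inj_onD)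
        then show "p x0 = q x0" using separates[of "p x0" "q x0"] pq x0S eE by metis
      qed
    qed
    let ?TE = "subtopology T E"
    have topTE: "topspace ?TE = E" using ellis_subset by (simp add: Int_absorb1)
    have eval: "continuous_map ?TE X (\<lambda>p. p x)" if "x \<in> S" for x
      using continuous_eval[OF that] continuous_map_from_subtopology by blast
    have onto: "(\<lambda>p. p x) ` topspace ?TE = S" if "x \<in> S" for x
      using ellis_orbit[OF dense[OF that] that] topTE by simp
    have "compact_space ?TE"
      using compact_space_subtopology[OF closedin_compact_space[OF compact_T closedin_ellis]] .
    \<comment> \<open>A continuous surjection from a compact onto a Hausdorff space is a quotient
      map, so \<open>p x0 \<mapsto> p y0\<close> descends to a continuous \<open>f\<close>.\<close>
    then have "quotient_map ?TE X (\<lambda>p. p x0)"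
      using eval[OF x0S] onto[OF x0S] Hausdorff
      by (intro continuous_closed_imp_quotient_map continuous_imp_closed_map) auto
    then obtain f where f: "continuous_map X X f" "f ` S = (\<lambda>p. p y0) ` topspace ?TE"
        "\<And>p. p \<in> topspace ?TE \<Longrightarrow> f (p x0) = p y0"
      using quotient_map_lift_exists[OF _ eval[OF y0S], of X "\<lambda>p. p x0"] iff topTE by metis
    have fp: "f (p x0) = p y0" if "p \<in> E" for p using f(3)[unfolded topTE] that by blast
    have finj: "inj_on f S"
    proof (rule inj_onI)
      fix u v assume uv: "u \<in> S" "v \<in> S" "f u = f v"
      then obtain p q where "p \<in> E" "u = p x0" "q \<in> E" "v = q x0" using orbit x0S by metis
      with uv(3) fp iff show "u = v" by metis
    qed
    have fimg: "f ` S = S" using f(2) onto[OF y0S] by simp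
    have equiv: "f (\<alpha> t u) = \<alpha> t (f u)" if "u \<in> S" for t u
    proof -
      obtain p where p: "p \<in> E" "u = p x0" using orbit x0S \<open>u \<in> S\<close> by metis
      have "f (compose S (act t) p x0) = compose S (act t) p y0"
        using fp act_compose_ellis p(1) by blast
      then show ?thesis using p x0S y0S ellis_closed[OF p(1)] fp[OF p(1)] by (simp add: compose_eq)
    qed
    define \<Phi> where "\<Phi> = restrict f S"
    have \<Phi>eq: "\<Phi> u = f u" if "u \<in> S" for u using that by (simp add: \<Phi>_def)
    have "homeomorphic_map X X \<Phi>"
    proof (rule continuous_imp_homeomorphic_map[OF _ compact Hausdorff])
      show "continuous_map X X \<Phi>" using f(1) continuous_map_eq \<Phi>eq by metis
      show "\<Phi> ` S = S" using fimg \<Phi>eq by (metis image_cong)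
      show "inj_on \<Phi> S" using finj \<Phi>eq by (simp add: inj_on_def)
    qed
    moreover have "\<Phi> \<in> Bij S" using finj fimg by (auto simp: Bij_def \<Phi>_def bij_betw_def)
    ultimately have "\<Phi> \<in> carrier ?A"
      using equiv \<Phi>eq action_closed by (simp add: automorphism_iff)
    \<comment> \<open>That \<open>f\<close> extends \<open>h\<close> follows from
      \<open>x = e (p x0)\<close> and \<open>transfer\<close>.\<close>
    moreover have "h x = f x" if x: "x \<in> e ` S" for x
    proof -
      obtain p where p: "p \<in> E" "x = p x0" using orbit x0S x eS by blast
      have "h x = h (e (p x0))" using efix[OF x] p by simp
      also have "\<dots> = e (p y0)" using transfer p by simp
      also have "\<dots> = f (compose S e p x0)"
        using fp[OF ellis_compose[OF eE p(1)]] y0S by (simp add: compose_eq)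
      also have "\<dots> = f x" using efix[OF x] p x0S by (simp add: compose_eq)
      finally show ?thesis .
    qed
    then have "h = ?R \<Phi>"
      using Bij_imp_extensional[OF hB] eS \<Phi>eq
      by (intro extensionalityI[of h "e ` S" "?R \<Phi>"]) auto
    ultimately show ?thesis by blast
  qed
  with hom inj automorphism_restrict[OF e] show "?R \<in> iso ?A ?V"
    by (auto simp: iso_def bij_betw_def)
qed

end


section \<open>Desubstitution\<close>

abbreviation full_shift :: "(int \<Rightarrow> 'a) topology" where
  "full_shift \<equiv> product_topology (\<lambda>_. discrete_topology UNIV) UNIV"

lemma compact_full_shift: "compact_space (full_shift :: (int \<Rightarrow> 'a::finite) topology)"
  by (simp add: compact_space_product_topology compact_space_discrete_topology)

lemma openin_cylinder: "openin full_shift {y. \<forall>j::int. \<bar>j\<bar> \<le> N \<longrightarrow> y j = x j}"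
proof -
  have "openin full_shift (PiE UNIV (\<lambda>j. if \<bar>j\<bar> \<le> N then {x j} else UNIV))"
  proof (rule product_topology_basis)
    have "{j. \<bar>j\<bar> \<le> N} \<subseteq> {-N..N}" by auto
    then have "finite {j::int. \<bar>j\<bar> \<le> N}" by (rule finite_subset) simp
    then show "finite {j. (if \<bar>j\<bar> \<le> N then {x j} else UNIV) \<noteq> topspace (discrete_topology UNIV)}"
      by (rule rev_finite_subset) auto
  qed auto
  also have "PiE UNIV (\<lambda>j. if \<bar>j\<bar> \<le> N then {x j} else UNIV) = {y. \<forall>j::int. \<bar>j\<bar> \<le> N \<longrightarrow> y j = x j}"
    by (auto simp: PiE_iff split: if_splits)
  finally show ?thesis .
qed

lemma openin_full_shift_imp_cylinder:
  assumes "openin full_shift U" "x \<in> U"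
  shows "\<exists>N. {y. \<forall>j::int. \<bar>j\<bar> \<le> N \<longrightarrow> y j = x j} \<subseteq> U"
proof -
  obtain V where V: "finite {j. V j \<noteq> UNIV}" "x \<in> PiE UNIV V" "PiE UNIV V \<subseteq> U"
    using assms unfolding openin_product_topology_alt by auto
  define N where "N = (\<Sum>j\<in>{j. V j \<noteq> UNIV}. \<bar>j\<bar>)"
  have N: "\<bar>j\<bar> \<le> N" if "V j \<noteq> UNIV" for j
    unfolding N_def using V(1) that by (intro member_le_sum) auto
  have "y \<in> PiE UNIV V" if "\<forall>j. \<bar>j\<bar> \<le> N \<longrightarrow> y j = x j" for y
    using that N V(2) by (fastforce simp: PiE_iff)
  with V(3) show ?thesis by blast
qed

text \<open>A point common to the nested closures of the tails is a cluster point, expressed through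
  windows.\<close>

lemma sequence_cluster:
  fixes Q :: "nat \<Rightarrow> int \<Rightarrow> 'a::finite"
  shows "\<exists>x. \<forall>N m. \<exists>n\<ge>m. \<forall>j. \<bar>j\<bar> \<le> N \<longrightarrow> Q n j = x j"
proof -
  let ?C = "\<lambda>m. full_shift closure_of (Q ` {m..})"
  have "\<Inter>(range ?C) \<noteq> {}"
  proof (rule compact_space_imp_nest[OF compact_full_shift])
    show "?C m \<noteq> {}" for m
      by (subst closure_of_eq_empty) auto
    show "decseq ?C"
      by (auto simp: decseq_def intro!: closure_of_mono)
  qed simp
  then obtain x where x: "\<And>m. x \<in> ?C m" by blast
  have *: "\<exists>n\<ge>m. \<forall>j. \<bar>j\<bar> \<le> N \<longrightarrow> Q n j = x j" for N m
  proof -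
    let ?U = "{y. \<forall>j. \<bar>j\<bar> \<le> N \<longrightarrow> y j = x j}"
    have "\<forall>T. x \<in> T \<and> openin full_shift T \<longrightarrow> (\<exists>y. y \<in> Q ` {m..} \<and> y \<in> T)"
      using x[of m] unfolding in_closure_of by (rule conjunct2)
    then have "\<exists>y. y \<in> Q ` {m..} \<and> y \<in> ?U"
      using openin_cylinder[of N x] by (elim allE[of _ ?U]) simp
    then show ?thesis by auto
  qed
  show ?thesis by (intro exI[of _ x] allI *)
qed

text \<open>Some tag occurs infinitely often, and the cluster point is taken along its indices. The
  tags will be residues and letter maps, which must stay constant in the limit.\<close>

lemma sequence_cluster_tagged:
  fixes Q :: "nat \<Rightarrow> int \<Rightarrow> 'a::finite"
  assumes "finite (range G)"
  shows "\<exists>x b. \<forall>N m. \<exists>n\<ge>m. G n = b \<and> (\<forall>j. \<bar>j\<bar> \<le> N \<longrightarrow> Q n j = x j)"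
proof -
  obtain n0 where inf: "infinite {n. G n = G n0}"
    using pigeonhole_infinite[of UNIV G] assms by auto
  define I where "I = enumerate {n. G n = G n0}"
  obtain x where x: "\<And>N m. \<exists>n\<ge>m. \<forall>j. \<bar>j\<bar> \<le> N \<longrightarrow> Q (I n) j = x j"
    using sequence_cluster[of "\<lambda>n. Q (I n)"] by metis
  have *: "\<exists>n\<ge>m. G n = G n0 \<and> (\<forall>j. \<bar>j\<bar> \<le> N \<longrightarrow> Q n j = x j)" for N m
  proof -
    obtain n where n: "n \<ge> m" "\<forall>j. \<bar>j\<bar> \<le> N \<longrightarrow> Q (I n) j = x j" using x by blast
    moreover have "G (I n) = G n0" using enumerate_in_set[OF inf] by (auto simp: I_def)
    moreover have "I n \<ge> m" using le_enumerate[OF inf, of n] n(1) by (simp add: I_def)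
    ultimately show ?thesis by metis
  qed
  show ?thesis by (intro exI[of _ x] exI[of _ "G n0"] allI *)
qed

section \<open>Iterates of a substitution of constant length\<close>

lemma subst_word_compose:
  "subst_word \<phi> (subst_word \<psi> w) = subst_word (\<lambda>a. subst_word \<phi> (\<psi> a)) w"
  by (induction w) (auto simp: subst_word_def)

lemma funpow_subst_word: "(subst_word \<theta> ^^ k) w = subst_word (subst_iter \<theta> k) w"
proof (induction k)
  case 0
  show ?case by (induction w) (auto simp: subst_word_def subst_iter_def)
next
  case (Suc k)
  have "subst_iter \<theta> (Suc k) a = subst_word \<theta> (subst_iter \<theta> k a)" for a
    by (simp add: subst_iter_def)
  then show ?case
    by (simp add: Suc.IH subst_word_compose)
qed

lemma subst_iter_add:
  "subst_iter \<theta> (m + k) a = subst_word (subst_iter \<theta> m) (subst_iter \<theta> k a)"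
  unfolding funpow_subst_word[symmetric] by (simp add: subst_iter_def funpow_add)

lemma subst_iter_Suc: "subst_iter \<theta> (Suc k) a = subst_word \<theta> (subst_iter \<theta> k a)"
  by (simp add: subst_iter_def)

lemma length_subst_word:
  "constant_length M \<phi> \<Longrightarrow> length (subst_word \<phi> w) = M * length w"
  by (induction w) (auto simp: subst_word_def constant_length_def)

lemma nth_subst_word:
  assumes "constant_length M \<phi>" "i < M * length w"
  shows "subst_word \<phi> w ! i = \<phi> (w ! (i div M)) ! (i mod M)"
  using assms(2)
proof (induction w arbitrary: i)
  case (Cons a w)
  have len: "length (\<phi> a) = M" using assms(1) by (simp add: constant_length_def)
  show ?case
  proof (cases "i < M")
    case True
    then show ?thesis using len by (simp add: subst_word_def nth_append)
  next
    case False
    have "M > 0" using Cons.prems by (cases M) auto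
    with False have "i div M = Suc ((i - M) div M)" "i mod M = (i - M) mod M"
      by (simp_all add: le_div_geq le_mod_geq)
    moreover have "subst_word \<phi> w ! (i - M) = \<phi> (w ! ((i - M) div M)) ! ((i - M) mod M)"
      using Cons.prems False by (intro Cons.IH) auto
    ultimately show ?thesis using False len by (simp add: subst_word_def nth_append)
  qed
qed simp

lemma constant_length_subst_iter:
  assumes "constant_length L \<theta>"
  shows "constant_length (L ^ k) (subst_iter \<theta> k)"
proof (induction k)
  case 0
  show ?case by (simp add: constant_length_def subst_iter_def)
next
  case (Suc k)
  then show ?case
    using assms by (auto simp: constant_length_def subst_iter_Suc length_subst_word[OF assms])
qed

text \<open>The letter map at position \<open>i\<close> of the next iterate is that of
  \<open>\<theta>\<close> at \<open>i mod L\<close> after that of the previous iterate at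
  \<open>i div L\<close>.\<close>

lemma bijective_subst_iter:
  assumes "bijective_subst L \<theta>"
  shows "bijective_subst (L ^ k) (subst_iter \<theta> k)"
proof (induction k)
  case 0
  show ?case by (simp add: bijective_subst_def constant_length_def subst_iter_def bij_id[unfolded id_def])
next
  case (Suc k)
  have cl: "constant_length L \<theta>" using assms by (simp add: bijective_subst_def)
  have "bij (\<lambda>a. subst_iter \<theta> (Suc k) a ! i)" if i: "i < L ^ Suc k" for i
  proof -
    have L: "L > 0" using i by (cases L) auto
    have "subst_iter \<theta> (Suc k) a ! i = \<theta> (subst_iter \<theta> k a ! (i div L)) ! (i mod L)" for a
      using i constant_length_subst_iter[OF cl, of k]
      by (simp add: subst_iter_Suc nth_subst_word[OF cl] constant_length_def)
    moreover have "bij (\<lambda>a. subst_iter \<theta> k a ! (i div L))"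
    proof -
      have "i div L < L ^ k" using i L by (simp add: div_less_iff_less_mult mult.commute)
      then show ?thesis using Suc.IH by (simp add: bijective_subst_def)
    qed
    moreover have "bij (\<lambda>b. \<theta> b ! (i mod L))"
      using assms L by (simp add: bijective_subst_def)
    ultimately show ?thesis
      using bij_comp[of "\<lambda>a. subst_iter \<theta> k a ! (i div L)" "\<lambda>b. \<theta> b ! (i mod L)"]
      by (simp add: comp_def)
  qed
  then show ?case
    using constant_length_subst_iter[OF cl, of "Suc k"] by (simp add: bijective_subst_def)
qed

section \<open>Points of the shift space and their preimages at level \<open>k\<close>\<close>

lemma sublist_window:
  assumes "0 \<le> q + a" "q + b < int (length u)"
  shows "sublist (map (\<lambda>i. u ! nat (q + i)) [a..b]) u"
proof -
  have "map (\<lambda>i. u ! nat (q + i)) [a..b] = take (nat (b - a + 1)) (drop (nat (q + a)) u)"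
    using assms by (intro nth_equalityI) (auto simp: nth_upto algebra_simps nat_add_distrib intro!: arg_cong[where f="nth u"])
  then show ?thesis using sublist_order.order.trans[OF sublist_take sublist_drop] by simp
qed

text \<open>Only the window of each \<open>y\<close> has to be admissible, because approximants read
  off a finite word are meaningless outside it.\<close>

lemma subst_shift_space_local:
  assumes "\<And>N::int. \<exists>y. (\<forall>a b. -N \<le> a \<longrightarrow> b \<le> N \<longrightarrow> allowed_word \<theta> (map y [a..b])) \<and> (\<forall>j. \<bar>j\<bar> \<le> N \<longrightarrow> y j = x j)"
  shows "x \<in> subst_shift_space \<theta>"
  unfolding subst_shift_space_def
proof (intro CollectI allI)
  fix a b :: int
  define N where "N = \<bar>a\<bar> + \<bar>b\<bar>"
  obtain y where y: "\<forall>a b. -N \<le> a \<longrightarrow> b \<le> N \<longrightarrow> allowed_word \<theta> (map y [a..b])" "\<forall>j. \<bar>j\<bar> \<le> N \<longrightarrow> y j = x j"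
    using assms by blast
  have "map x [a..b] = map y [a..b]"
    using y(2) by (auto simp: N_def)
  moreover have "allowed_word \<theta> (map y [a..b])" using y(1) by (simp add: N_def)
  ultimately show "allowed_word \<theta> (map x [a..b])" by metis
qed

lemma shift_in_space: "x \<in> subst_shift_space \<theta> \<Longrightarrow> shift t x \<in> subst_shift_space \<theta>"
proof -
  have "map (shift t x) [a..b] = map x [a + t..b + t]" for a b
    by (intro nth_equalityI) (auto simp: shift_def nth_upto algebra_simps)
  then show "x \<in> subst_shift_space \<theta> \<Longrightarrow> ?thesis"
    by (simp add: subst_shift_space_def)
qed

text \<open>A two-letter word has to fit into an iterate of a letter, so some power of
  \<open>L\<close> exceeds 1.\<close>

lemma length_ge_2:
  assumes "constant_length L \<theta>" "x \<in> subst_shift_space \<theta>"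
  shows "L \<ge> 2"
proof (rule ccontr)
  assume L: "\<not> L \<ge> 2"
  obtain k a where "sublist (map x [0..1]) (subst_iter \<theta> k a)"
    using assms(2) unfolding subst_shift_space_def allowed_word_def by blast
  then have "length (map x [0..1]) \<le> length (subst_iter \<theta> k a)" by (rule sublist_length_le)
  then have "2 \<le> L ^ k" using constant_length_subst_iter[OF assms(1), of k] by (simp add: constant_length_def)
  with L show False using power_le_one[of L k] by simp
qed

text \<open>The action of \<open>\<phi>\<close> with block length \<open>M\<close> on bi-infinite
  sequences, the image of \<open>y 0\<close> starting at coordinate 0. On \<open>int\<close>,
  \<open>div\<close> and \<open>mod\<close> round down, so negative coordinates are covered.\<close>

definition inflate :: "('a \<Rightarrow> 'a list) \<Rightarrow> nat \<Rightarrow> (int \<Rightarrow> 'a) \<Rightarrow> int \<Rightarrow> 'a" where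
  "inflate \<phi> M y = (\<lambda>j. \<phi> (y (j div int M)) ! nat (j mod int M))"

lemma inflate_block:
  "0 \<le> i \<Longrightarrow> i < int M \<Longrightarrow> inflate \<phi> M y (int M * t + i) = \<phi> (y t) ! nat i"
  by (simp add: inflate_def)

text \<open>A window of \<open>x\<close> longer than a level-\<open>k\<close> block lies in an
  iterate of order \<open>n \<ge> k\<close>, which is the level-\<open>k\<close> image of a finite
  word \<open>u\<close>. Only the part of \<open>y\<close> read off \<open>u\<close> is
  controlled.\<close>

lemma desubstitution_window:
  fixes N :: nat
  assumes cl: "constant_length L \<theta>" and L: "L \<ge> 2" and x: "x \<in> subst_shift_space \<theta>"
  shows "\<exists>r y. 0 \<le> r \<and> r < int (L ^ k) \<and>
     (\<forall>a b. -int N \<le> a \<longrightarrow> b \<le> int N \<longrightarrow> allowed_word \<theta> (map y [a..b])) \<and>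
     (\<forall>j. \<bar>j\<bar> \<le> int N \<longrightarrow> x j = inflate (subst_iter \<theta> k) (L ^ k) y (j + r))"
proof -
  define M where "M = L ^ k"
  define \<phi> where "\<phi> = subst_iter \<theta> k"
  \<comment> \<open>The block beyond \<open>N\<close> absorbs the offset \<open>r\<close>, keeping
    the needed letters inside \<open>u\<close>, and makes the window longer than \<open>M\<close>,
    which forces \<open>n \<ge> k\<close>.\<close>
  define W where "W = M * (N + 1)"
  have M: "M > 0" using L by (simp add: M_def)
  have cl\<phi>: "constant_length M \<phi>" using constant_length_subst_iter[OF cl] by (simp add: M_def \<phi>_def)
  let ?w = "map x [-int W..int W]"
  obtain n a where "sublist ?w (subst_iter \<theta> n a)"
    using x unfolding subst_shift_space_def allowed_word_def by blast
  then obtain ps ss where w: "subst_iter \<theta> n a = ps @ ?w @ ss" by (auto simp: sublist_def)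
  have len: "length (subst_iter \<theta> n a) = L ^ n"
    using constant_length_subst_iter[OF cl] by (simp add: constant_length_def)
  have "W \<ge> M" by (simp add: W_def)
  then have "length ?w > M" using M by simp
  then have "L ^ n > L ^ k" using w len by (simp add: M_def)
  then have "n \<ge> k" using L power_increasing[of n k L] by (cases "n \<ge> k") auto
  define u where "u = subst_iter \<theta> (n - k) a"
  have sub: "subst_iter \<theta> n a = subst_word \<phi> u"
    using subst_iter_add[of \<theta> k "n - k" a] \<open>n \<ge> k\<close> by (simp add: \<phi>_def u_def)
  \<comment> \<open>The place of coordinate 0 of \<open>x\<close> in the long word: offset
    \<open>r\<close> in the block of letter \<open>q\<close> of \<open>u\<close>.\<close>
  define c where "c = length ps + W"
  define q where "q = c div M"
  define r where "r = c mod M"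
  define y where "y = (\<lambda>i. u ! nat (int q + i))"
  have c: "c = M * q + r" by (simp add: q_def r_def)
  have r: "r < M" using M by (simp add: r_def)
  have total: "c + W < M * length u"
    using w sub length_subst_word[OF cl\<phi>, of u] by (simp add: c_def)
  have xj: "x j = inflate \<phi> M y (j + int r)" if j: "\<bar>j\<bar> \<le> int W" for j
  proof -
    define i where "i = nat (int c + j)"
    have i: "int i = int c + j" using j by (simp add: i_def c_def)
    have "i < M * length u" using i total j by linarith
    have "[- int W..int W] ! nat (j + int W) = j"
      using j by (subst nth_upto) linarith+
    then have "x j = ?w ! nat (j + int W)"
      using j by (subst nth_map) auto
    also have "\<dots> = (ps @ ?w @ ss) ! i"
    proof -
      have "i = length ps + nat (j + int W)" "nat (j + int W) < length ?w"
        using i j by (auto simp: c_def)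
      then show ?thesis by (simp only: nth_append_length_plus nth_append) simp
    qed
    also have "\<dots> = \<phi> (u ! (i div M)) ! (i mod M)"
      using nth_subst_word[OF cl\<phi> \<open>i < M * length u\<close>] sub w by simp
    also have "\<dots> = inflate \<phi> M y (j + int r)"
    proof -
      have eq: "int i = (j + int r) + int M * int q" using i c by simp
      have "int (i div M) = int q + (j + int r) div int M"
        unfolding zdiv_int eq using M by (simp add: div_mult_self2)
      moreover have "int (i mod M) = (j + int r) mod int M"
        unfolding zmod_int eq by simp
      ultimately show ?thesis
        unfolding inflate_def y_def by (metis nat_int)
    qed
    finally show ?thesis .
  qed
  have "allowed_word \<theta> (map y [a..b])" if ab: "-int N \<le> a" "b \<le> int N" for a b
  proof (cases "a \<le> b")
    case True
    have "0 \<le> int q + a"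
    proof -
      have "int c \<ge> int W" by (simp add: c_def)
      then have "int M * (int q + a) + int r \<ge> int M * (int N + 1 + a)"
        using c by (simp add: W_def algebra_simps)
      moreover have "int M * (int N + 1 + a) \<ge> int M * 1"
        using ab M by (intro mult_left_mono) auto
      ultimately have "int M * (int q + a) > 0" using r by linarith
      then show ?thesis using M by (simp add: zero_less_mult_iff)
    qed
    moreover have "int q + b < int (length u)"
    proof -
      have "int M * (int q + b) \<le> int M * int q + int M * int N"
        using ab M by (simp add: algebra_simps)
      also have "\<dots> \<le> int (c + W)" using c by (simp add: W_def algebra_simps)
      also have "\<dots> < int M * int (length u)" using total by (metis of_nat_less_iff of_nat_mult)
      finally show ?thesis using M by simp
    qed
    ultimately have "sublist (map y [a..b]) u" unfolding y_def by (rule sublist_window)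
    then show ?thesis by (auto simp: allowed_word_def u_def)
  next
    case False
    then show ?thesis by (auto simp: allowed_word_def)
  qed
  moreover have "W \<ge> N" using M by (cases M) (simp_all add: W_def)
  ultimately show ?thesis
    using r xj unfolding M_def \<phi>_def by (intro exI[of _ "int r"] exI[of _ y]) auto
qed

text \<open>The residue takes finitely many values, so it stays fixed while the partial preimages
  cluster at a point of the shift space.\<close>

lemma desubstitution:
  fixes \<theta> :: "'a::finite \<Rightarrow> 'a list"
  assumes cl: "constant_length L \<theta>" and L: "L \<ge> 2" and x: "x \<in> subst_shift_space \<theta>"
  shows "\<exists>r y. 0 \<le> r \<and> r < int (L ^ k) \<and> y \<in> subst_shift_space \<theta> \<and>
     x = shift r (inflate (subst_iter \<theta> k) (L ^ k) y)"
proof -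
  obtain R Y where RY: "\<And>N. 0 \<le> R N \<and> R N < int (L ^ k)"
      "\<And>N a b. -int N \<le> a \<Longrightarrow> b \<le> int N \<Longrightarrow> allowed_word \<theta> (map (Y N) [a..b])"
      "\<And>N j. \<bar>j\<bar> \<le> int N \<Longrightarrow> x j = inflate (subst_iter \<theta> k) (L ^ k) (Y N) (j + R N)"
    using desubstitution_window[OF cl L x, of k] by metis
  have "range R \<subseteq> {0..<int (L ^ k)}" using RY(1) by auto
  then have "finite (range R)" by (rule finite_subset) simp
  then obtain y r where yr: "\<And>N m. \<exists>n\<ge>m. R n = r \<and> (\<forall>j. \<bar>j\<bar> \<le> N \<longrightarrow> Y n j = y j)"
    using sequence_cluster_tagged[of R Y] by blast
  have "y \<in> subst_shift_space \<theta>"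
  proof (rule subst_shift_space_local)
    fix N :: int
    obtain n where "n \<ge> nat N" "\<forall>j. \<bar>j\<bar> \<le> N \<longrightarrow> Y n j = y j" using yr by blast
    then show "\<exists>y'. (\<forall>a b. -N \<le> a \<longrightarrow> b \<le> N \<longrightarrow> allowed_word \<theta> (map y' [a..b])) \<and> (\<forall>j. \<bar>j\<bar> \<le> N \<longrightarrow> y' j = y j)"
      using RY(2)[of n] by (intro exI[of _ "Y n"]) auto
  qed
  moreover have "x j = shift r (inflate (subst_iter \<theta> k) (L ^ k) y) j" for j
  proof -
    obtain n where n: "n \<ge> nat \<bar>j\<bar>" "R n = r" "\<And>i. \<bar>i\<bar> \<le> \<bar>(j + r) div int (L ^ k)\<bar> \<Longrightarrow> Y n i = y i"
      using yr by blast
    then show ?thesis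
      using RY(3)[of j n] by (simp add: shift_def inflate_def)
  qed
  moreover have "0 \<le> r \<and> r < int (L ^ k)" using yr[of 0 0] RY(1) by metis
  ultimately show ?thesis by (intro exI[of _ r] exI[of _ y]) (simp add: fun_eq_iff)
qed


section \<open>How often two distinct points differ\<close>

text \<open>Otherwise a limit \<open>x\<close> follows a single map \<open>g\<close> along all
  integers. Two powers of \<open>g\<close> coincide, as the alphabet is finite, and \<open>x\<close>
  is periodic.\<close>

lemma no_long_deterministic_window:
  fixes \<theta> :: "'a::finite \<Rightarrow> 'a list"
  assumes "aperiodic_subst \<theta>"
  shows "\<exists>J::nat. \<forall>y\<in>subst_shift_space \<theta>. \<forall>g t. \<exists>i\<ge>t. i < t + int J \<and> y (i + 1) \<noteq> g (y i)"
proof (rule ccontr)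
  assume "\<not> ?thesis"
  then have "\<forall>J::nat. \<exists>y g t. y \<in> subst_shift_space \<theta> \<and> (\<forall>i\<ge>t. i < t + int J \<longrightarrow> y (i + 1) = g (y i))"
    by simp metis
  then obtain Y G T where Y: "\<And>J. Y J \<in> subst_shift_space \<theta>"
    and det: "\<And>J i. T J \<le> i \<Longrightarrow> i < T J + int J \<Longrightarrow> Y J (i + 1) = G J (Y J i)"
    by metis
  \<comment> \<open>Windows of length \<open>2 * N\<close> are centred at 0, so that they exhaust
    the integers in the limit.\<close>
  define Q where "Q N = shift (T (2 * N) + int N) (Y (2 * N))" for N
  have Q: "Q N \<in> subst_shift_space \<theta>" for N
    unfolding Q_def by (intro shift_in_space Y)
  have Qdet: "Q N (i + 1) = G (2 * N) (Q N i)" if "- int N \<le> i" "i < int N" for N i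
    using det[of "2 * N" "i + (T (2 * N) + int N)"] that by (simp add: Q_def shift_def algebra_simps)
  have "finite (range (\<lambda>N. G (2 * N)))"
    by (rule finite_subset[of _ UNIV]) auto
  from sequence_cluster_tagged[OF this, of Q] obtain x g where
    xg: "\<And>N m. \<exists>n\<ge>m. G (2 * n) = g \<and> (\<forall>j. \<bar>j\<bar> \<le> N \<longrightarrow> Q n j = x j)"
    by metis
  have x: "x \<in> subst_shift_space \<theta>"
  proof (rule subst_shift_space_local)
    fix N :: int
    obtain n where "\<forall>j. \<bar>j\<bar> \<le> N \<longrightarrow> Q n j = x j" using xg[of 0 N] by metis
    then show "\<exists>y. (\<forall>a b. -N \<le> a \<longrightarrow> b \<le> N \<longrightarrow> allowed_word \<theta> (map y [a..b])) \<and> (\<forall>j. \<bar>j\<bar> \<le> N \<longrightarrow> y j = x j)"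
      using Q[of n] by (intro exI[of _ "Q n"]) (simp add: subst_shift_space_def)
  qed
  have step: "x (i + 1) = g (x i)" for i
  proof -
    obtain n where n: "n \<ge> nat (\<bar>i\<bar> + 1)" "G (2 * n) = g" "\<forall>j. \<bar>j\<bar> \<le> \<bar>i\<bar> + 1 \<longrightarrow> Q n j = x j"
      using xg[of "nat (\<bar>i\<bar> + 1)" "\<bar>i\<bar> + 1"] by metis
    have "Q n (i + 1) = G (2 * n) (Q n i)" using n(1) by (intro Qdet) linarith+
    with n(2,3) show ?thesis by simp
  qed
  have iter: "x (i + int n) = (g ^^ n) (x i)" for i n
  proof (induction n)
    case (Suc n)
    then show ?case using step[of "i + int n"] by (simp add: algebra_simps)
  qed simp
  have "\<not> inj (\<lambda>n. g ^^ n)"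
    using finite_imageD[of "\<lambda>n. g ^^ n" UNIV] finite_subset[OF subset_UNIV] by auto
  then obtain a b where "a \<noteq> b" "g ^^ a = g ^^ b" by (auto simp: inj_def)
  then obtain a b where ab: "a < b" "g ^^ a = g ^^ b" by (metis linorder_neqE_nat)
  \<comment> \<open>Both values are computed forwards from position \<open>j - a\<close>, so no
    inverse of \<open>g\<close> enters.\<close>
  have "shift (int (b - a)) x j = x j" for j
    using iter[of "j - int a" b] iter[of "j - int a" a] ab by (simp add: shift_def algebra_simps of_nat_diff)
  then have "shift (int (b - a)) x = x" by (rule ext)
  with x ab(1) assms show False
    unfolding aperiodic_subst_def by (metis of_nat_0_less_iff zero_less_diff)
qed

text \<open>Under agreement, block \<open>t\<close> of \<open>w\<close> starts inside block
  \<open>t\<close> of \<open>v\<close>, so \<open>y t\<close> determines \<open>z t\<close>; block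
  \<open>t + 1\<close> of \<open>v\<close> starts inside block \<open>t\<close> of \<open>w\<close>,
  so \<open>z t\<close> determines \<open>y (t + 1)\<close>.\<close>

lemma different_residues:
  assumes bij: "bijective_subst M \<phi>"
    and J: "\<And>g t. \<exists>i\<ge>t. i < t + int J \<and> y (i + 1) \<noteq> g (y i)"
    and rs: "0 \<le> s" "s < r" "r < int M"
    and v: "v = shift r (inflate \<phi> M y)" and w: "w = shift s (inflate \<phi> M z)"
  shows "\<exists>j. \<bar>j\<bar> \<le> int M * (int J + 2) \<and> v (n + j) \<noteq> w (n + j)"
proof (rule ccontr)
  \<comment> \<open>\<open>J\<close> blocks for the run in \<open>y\<close>, one for rounding up to
    \<open>t0\<close>, one for the reach into the following block.\<close>
  define N where "N = int M * (int J + 2)"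
  assume "\<not> ?thesis"
  then have "v (n + (i - n)) = w (n + (i - n))" if "\<bar>i - n\<bar> \<le> N" for i
    using that unfolding N_def by blast
  then have agree: "v i = w i" if "n - N \<le> i" "i \<le> n + N" for i
    using that by (simp add: abs_le_iff)
  define d where "d = r - s"
  have d: "0 < d" "d < int M" using rs by (auto simp: d_def)
  have M: "int M > 0" using rs by linarith
  \<comment> \<open>Index of the first block of \<open>w\<close> starting strictly after the left
    end of the window.\<close>
  define t0 where "t0 = (n - N + s) div int M + 1"
  have t0: "int M * t0 > n - N + s" "int M * t0 \<le> n - N + s + int M"
  proof -
    have "n - N + s = int M * ((n - N + s) div int M) + (n - N + s) mod int M" by simp
    moreover have "0 \<le> (n - N + s) mod int M" "(n - N + s) mod int M < int M" using M by simp_all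
    ultimately show "int M * t0 > n - N + s" "int M * t0 \<le> n - N + s + int M"
      unfolding t0_def distrib_left by linarith+
  qed
  have inj: "a = b" if "\<phi> a ! i = \<phi> b ! i" "i < M" for a b i
    using bij that unfolding bijective_subst_def bij_def inj_def by blast
  define p where "p i b = (THE a. \<phi> a ! i = b)" for i b
  have p: "p i (\<phi> a ! i) = a" if "i < M" for i a
    unfolding p_def using inj that by (intro the_equality) auto
  \<comment> \<open>\<open>p i\<close> inverts the letter map at position \<open>i\<close>.
    \<open>g\<close> passes from \<open>y t\<close> to \<open>z t\<close> at offset
    \<open>d\<close>, then to \<open>y (t + 1)\<close> at offset \<open>M - d\<close>, independently
    of \<open>t\<close>.\<close>
  define g where "g b = p 0 (\<phi> (p 0 (\<phi> b ! nat d)) ! nat (int M - d))" for b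
  have "y (t + 1) = g (y t)" if t: "t0 \<le> t" "t < t0 + int J" for t
  proof -
    have lo: "int M * t \<ge> int M * t0" using t M by simp
    have "int M * t \<le> int M * (t0 + int J)" using t M by simp
    then have hi: "int M * t \<le> int M * t0 + int M * int J" by (simp add: distrib_left)
    have N: "N = int M * int J + 2 * int M" by (simp add: N_def algebra_simps)
    have win: "n - N \<le> int M * t - s + i \<and> int M * t - s + i \<le> n + N" if "0 \<le> i" "i \<le> int M" for i
      using that lo hi t0 N rs M zero_le_mult_iff[of "int M" "int J"] by linarith
    have "v (int M * t - s) = w (int M * t - s)" using agree win[of 0] M by simp
    moreover have "v (int M * t - s) = \<phi> (y t) ! nat d"
      using inflate_block[of d M \<phi> y t] d by (simp add: v shift_def d_def algebra_simps)
    moreover have "w (int M * t - s) = \<phi> (z t) ! 0"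
      using inflate_block[of 0 M \<phi> z t] M by (simp add: w shift_def)
    ultimately have zt: "z t = p 0 (\<phi> (y t) ! nat d)" using p[of 0 "z t"] M by simp
    have "v (int M * t - s + (int M - d)) = w (int M * t - s + (int M - d))" using agree win[of "int M - d"] d by simp
    moreover have "v (int M * t - s + (int M - d)) = \<phi> (y (t + 1)) ! 0"
      using inflate_block[of 0 M \<phi> y "t + 1"] M by (simp add: v shift_def d_def algebra_simps)
    moreover have "w (int M * t - s + (int M - d)) = \<phi> (z t) ! nat (int M - d)"
      using inflate_block[of "int M - d" M \<phi> z t] d by (simp add: w shift_def algebra_simps)
    ultimately have "y (t + 1) = p 0 (\<phi> (z t) ! nat (int M - d))" using p[of 0 "y (t + 1)"] M by simp
    then show ?thesis by (simp add: g_def zt)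
  qed
  with J[of t0 g] show False by blast
qed

text \<open>Equal offsets cut both points into the same blocks. A difference at \<open>c\<close>
  comes from different preimage letters, and every letter map is injective.\<close>

lemma equal_residues:
  assumes bij: "bijective_subst M \<phi>" and M: "M > 0"
    and v: "v = shift r (inflate \<phi> M y)" and w: "w = shift r (inflate \<phi> M z)" and c: "v c \<noteq> w c"
  shows "\<exists>a\<le>c. c < a + int M \<and> (\<forall>j\<ge>a. j < a + int M \<longrightarrow> v j \<noteq> w j)"
proof (intro exI conjI allI impI)
  define t where "t = (c + r) div int M"
  define a where "a = int M * t - r"
  have cr: "c + r = int M * t + (c + r) mod int M" by (simp add: t_def)
  have m: "0 \<le> (c + r) mod int M" "(c + r) mod int M < int M" using M by simp_all
  show "a \<le> c" "c < a + int M" using cr m unfolding a_def by linarith+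
  have "y t \<noteq> z t" using c by (auto simp: v w shift_def inflate_def t_def)
  fix j assume j: "a \<le> j" "j < a + int M"
  define i where "i = j - a"
  have i: "0 \<le> i" "i < int M" "j + r = int M * t + i" using j by (auto simp: i_def a_def)
  have "v j = \<phi> (y t) ! nat i" "w j = \<phi> (z t) ! nat i"
    unfolding v w shift_def i(3) using inflate_block[OF i(1,2)] by auto
  moreover have "inj (\<lambda>a. \<phi> a ! nat i)"
    using bij i unfolding bijective_subst_def by (simp add: bij_is_inj nat_less_iff)
  ultimately show "v j \<noteq> w j" using \<open>y t \<noteq> z t\<close> by (auto dest: injD)
qed

text \<open>\<open>\<epsilon>\<close> gives the direction of the ray along which differences recur.
  Different residues at some level give recurrence everywhere; otherwise \<open>v\<close> and
  \<open>w\<close> differ at every point of a ray, and \<open>N = 0\<close>.\<close>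

lemma differences_syndetic:
  fixes \<theta> :: "'a::finite \<Rightarrow> 'a list"
  assumes bij: "bijective_subst L \<theta>" and aper: "aperiodic_subst \<theta>"
    and v: "v \<in> subst_shift_space \<theta>" and w: "w \<in> subst_shift_space \<theta>" and "v \<noteq> w"
  shows "\<exists>\<epsilon> N c. (\<epsilon> = 1 \<or> \<epsilon> = (-1::int)) \<and> (\<forall>n. \<epsilon> * n \<ge> c \<longrightarrow> (\<exists>j. \<bar>j\<bar> \<le> N \<and> v (n + j) \<noteq> w (n + j)))"
proof -
  have cl: "constant_length L \<theta>" using bij by (simp add: bijective_subst_def)
  have L: "L \<ge> 2" using length_ge_2[OF cl v] .
  have "\<exists>r y. 0 \<le> r \<and> r < int (L ^ k) \<and> y \<in> subst_shift_space \<theta> \<and> x = shift r (inflate (subst_iter \<theta> k) (L ^ k) y)"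
    if "x \<in> subst_shift_space \<theta>" for x k
    using desubstitution[OF cl L that] .
  then obtain r y where r: "\<And>x k. x \<in> subst_shift_space \<theta> \<Longrightarrow> 0 \<le> r x k \<and> r x k < int (L ^ k)"
    and y: "\<And>x k. x \<in> subst_shift_space \<theta> \<Longrightarrow> y x k \<in> subst_shift_space \<theta>"
    and xy: "\<And>x k. x \<in> subst_shift_space \<theta> \<Longrightarrow> x = shift (r x k) (inflate (subst_iter \<theta> k) (L ^ k) (y x k))"
    by metis
  show ?thesis
  proof (cases "\<exists>k. r v k \<noteq> r w k")
    case True
    then obtain k where k: "r v k \<noteq> r w k" by blast
    obtain J :: nat where J: "\<And>y g t. y \<in> subst_shift_space \<theta> \<Longrightarrow> \<exists>i\<ge>t. i < t + int J \<and> y (i + 1) \<noteq> g (y i)"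
      using no_long_deterministic_window[OF aper] by metis
    note res = different_residues[OF bijective_subst_iter[OF bij, of k], where J = J]
    have "\<exists>j. \<bar>j\<bar> \<le> int (L ^ k) * (int J + 2) \<and> v (n + j) \<noteq> w (n + j)" for n
    proof (cases "r w k < r v k")
      case True
      show ?thesis
        by (rule res[OF J[OF y[OF v, of k]] _ True _ xy[OF v] xy[OF w]]) (use r[OF v, of k] r[OF w, of k] in auto)
    next
      case False
      with k have "r v k < r w k" by simp
      then have "\<exists>j. \<bar>j\<bar> \<le> int (L ^ k) * (int J + 2) \<and> w (n + j) \<noteq> v (n + j)"
        by (intro res[OF J[OF y[OF w, of k]] _ _ _ xy[OF w] xy[OF v]]) (use r[OF v, of k] r[OF w, of k] in auto)
      then show ?thesis by metis
    qed
    then show ?thesis by blast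
  next
    case False
    obtain c where c: "v c \<noteq> w c" using \<open>v \<noteq> w\<close> by blast
    have block: "\<exists>a\<le>c. c < a + int (L ^ k) \<and> (\<forall>j\<ge>a. j < a + int (L ^ k) \<longrightarrow> v j \<noteq> w j)" for k
    proof (rule equal_residues[OF bijective_subst_iter[OF bij, of k]])
      show "v = shift (r v k) (inflate (subst_iter \<theta> k) (L ^ k) (y v k))" by (rule xy[OF v])
      show "w = shift (r v k) (inflate (subst_iter \<theta> k) (L ^ k) (y w k))"
        using xy[OF w, of k] False by metis
    qed (use L c in auto)
    \<comment> \<open>The differing blocks around \<open>c\<close> grow with \<open>k\<close> but
      may extend to either side. A block longer than \<open>n1 - n2\<close> would contain one of two
      agreements on opposite sides of \<open>c\<close>.\<close>
    have "(\<forall>n\<ge>c. v n \<noteq> w n) \<or> (\<forall>n\<le>c. v n \<noteq> w n)"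
    proof (rule ccontr)
      assume "\<not> ?thesis"
      then obtain n1 n2 where n: "n1 \<ge> c" "v n1 = w n1" "n2 \<le> c" "v n2 = w n2" by blast
      define k where "k = nat (n1 - n2)"
      have "k < L ^ k" using L by (intro less_le_trans[OF less_exp power_mono]) auto
      then have k: "n1 - n2 < int (L ^ k)" by (simp add: k_def del: of_nat_power)
      obtain a where a: "a \<le> c" "c < a + int (L ^ k)" "\<And>j. a \<le> j \<Longrightarrow> j < a + int (L ^ k) \<Longrightarrow> v j \<noteq> w j"
        using block[of k] by metis
      have "\<not> n1 < a + int (L ^ k)" using a(3)[of n1] n a(1) by linarith
      moreover have "\<not> a \<le> n2" using a(3)[of n2] n a(2) by linarith
      ultimately show False using k by linarith
    qed
    then show ?thesis
    proof
      assume *: "\<forall>n\<ge>c. v n \<noteq> w n"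
      show ?thesis
        by (rule exI[of _ 1], rule exI[of _ 0], rule exI[of _ c]) (use * in auto)
    next
      assume *: "\<forall>n\<le>c. v n \<noteq> w n"
      show ?thesis
        by (rule exI[of _ "-1"], rule exI[of _ 0], rule exI[of _ "-c"]) (use * in auto)
    qed
  qed
qed

text \<open>The window of \<open>y\<close> lies in an iterate of \<open>a\<close>, and by
  primitivity \<open>a\<close> occurs in the \<open>k\<close>-th iterate of \<open>z 0\<close>; so
  the window occurs in the block of \<open>x\<close> coming from \<open>z 0\<close>.\<close>

lemma orbit_meets_cylinder:
  fixes \<theta> :: "'a::finite \<Rightarrow> 'a list"
  assumes cl: "constant_length L \<theta>" and prim: "primitive_subst \<theta>"
    and x: "x \<in> subst_shift_space \<theta>" and y: "y \<in> subst_shift_space \<theta>"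
  shows "\<exists>t. \<forall>j. \<bar>j\<bar> \<le> N \<longrightarrow> shift t x j = y j"
proof -
  have L: "L \<ge> 2" using length_ge_2[OF cl x] .
  obtain n a where "sublist (map y [-N..N]) (subst_iter \<theta> n a)"
    using y unfolding subst_shift_space_def allowed_word_def by blast
  moreover obtain k where k: "\<And>b. set (subst_iter \<theta> k b) = UNIV"
    using prim unfolding primitive_subst_def by blast
  obtain r z where rz: "0 \<le> r" "x = shift r (inflate (subst_iter \<theta> (n + k)) (L ^ (n + k)) z)"
    using desubstitution[OF cl L x, of "n + k"] by blast
  have "a \<in> set (subst_iter \<theta> k (z 0))" using k by simp
  then obtain us vs where "subst_iter \<theta> k (z 0) = us @ a # vs" by (meson split_list)
  then have "subst_iter \<theta> (n + k) (z 0) =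
      subst_word (subst_iter \<theta> n) us @ subst_iter \<theta> n a @ subst_word (subst_iter \<theta> n) vs"
    by (simp add: subst_iter_add subst_word_def)
  ultimately have "sublist (map y [-N..N]) (subst_iter \<theta> (n + k) (z 0))"
    by (auto intro: sublist_appendI sublist_append_leftI sublist_append_rightI sublist_order.order.trans)
  then obtain ps ss where w: "subst_iter \<theta> (n + k) (z 0) = ps @ map y [-N..N] @ ss"
    unfolding sublist_def by blast
  have len: "length (subst_iter \<theta> (n + k) (z 0)) = L ^ (n + k)"
    using constant_length_subst_iter[OF cl] by (simp add: constant_length_def)
  \<comment> \<open>The occurrence is centred at index \<open>length ps + N\<close> of that block,
    and subtracting \<open>r\<close> gives the coordinate in \<open>x\<close>.\<close>
  have "shift (int (length ps) + N - r) x j = y j" if j: "\<bar>j\<bar> \<le> N" for j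
  proof -
    define i where "i = nat (j + N)"
    have i: "int i = j + N" "i < length (map y [-N..N])" using j by (auto simp: i_def)
    have "length ps + i < L ^ (n + k)" using w len i(2) by simp
    then have "int (length ps + i) < int (L ^ (n + k))" by (simp del: of_nat_power)
    then have "inflate (subst_iter \<theta> (n + k)) (L ^ (n + k)) z (int (length ps + i))
        = subst_iter \<theta> (n + k) (z 0) ! (length ps + i)"
      using inflate_block[of "int (length ps + i)" "L ^ (n + k)" "subst_iter \<theta> (n + k)" z 0]
      by (simp del: of_nat_power of_nat_add)
    also have "\<dots> = map y [-N..N] ! i"
      using i(2) unfolding w by (simp only: nth_append_length_plus nth_append) simp
    also have "\<dots> = y j"
    proof -
      have "[-N..N] ! i = j" using i j by (subst nth_upto) linarith+
      then show ?thesis using i(2) by (subst nth_map) auto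
    qed
    finally show ?thesis using i(1) unfolding rz(2) by (simp add: shift_def algebra_simps)
  qed
  then show ?thesis by blast
qed


section \<open>The flow of a bijective substitution\<close>

lemma topspace_subst_topology [simp]: "topspace (subst_topology \<theta>) = subst_shift_space \<theta>"
  by (simp add: subst_topology_def)

lemma closedin_subst_shift_space: "closedin full_shift (subst_shift_space \<theta>)"
proof -
  have "x \<in> subst_shift_space \<theta>" if x: "x \<in> full_shift closure_of subst_shift_space \<theta>" for x
  proof (rule subst_shift_space_local)
    fix N :: int
    let ?U = "{y. \<forall>j. \<bar>j\<bar> \<le> N \<longrightarrow> y j = x j}"
    have "\<forall>T. x \<in> T \<and> openin full_shift T \<longrightarrow> (\<exists>y. y \<in> subst_shift_space \<theta> \<and> y \<in> T)"
      using x unfolding in_closure_of by (rule conjunct2)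
    then have "\<exists>y. y \<in> subst_shift_space \<theta> \<and> y \<in> ?U"
      using openin_cylinder[of N x] by (elim allE[of _ ?U]) simp
    then show "\<exists>y. (\<forall>a b. -N \<le> a \<longrightarrow> b \<le> N \<longrightarrow> allowed_word \<theta> (map y [a..b])) \<and> (\<forall>j. \<bar>j\<bar> \<le> N \<longrightarrow> y j = x j)"
      unfolding subst_shift_space_def by blast
  qed
  then have "full_shift closure_of subst_shift_space \<theta> \<subseteq> subst_shift_space \<theta>" by blast
  then show ?thesis by (simp add: closure_of_subset_eq[symmetric])
qed

lemma continuous_coordinate:
  "continuous_map (subst_topology \<theta>) (discrete_topology UNIV) (\<lambda>x. x j)"
  unfolding subst_topology_def
  by (intro continuous_map_from_subtopology continuous_map_product_projection) simp

lemma compact_flow_subst: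
  fixes \<theta> :: "'a::finite \<Rightarrow> 'a list"
  shows "compact_flow (subst_topology \<theta>) shift"
proof
  show "compact_space (subst_topology \<theta>)"
    unfolding subst_topology_def
    by (intro compact_space_subtopology closedin_compact_space[OF compact_full_shift] closedin_subst_shift_space)
  show "Hausdorff_space (subst_topology \<theta>)"
    unfolding subst_topology_def
    by (intro Hausdorff_space_subtopology) (simp add: Hausdorff_space_product_topology)
  show "continuous_map (subst_topology \<theta>) (subst_topology \<theta>) (shift t)" for t
  proof -
    have "continuous_map (subst_topology \<theta>) full_shift (shift t)"
      unfolding continuous_map_componentwise_UNIV shift_def using continuous_coordinate by blast
    moreover have "shift t ` subst_shift_space \<theta> \<subseteq> subst_shift_space \<theta>"
      using shift_in_space by blast
    ultimately show ?thesis
      by (subst (2) subst_topology_def) (auto simp: continuous_map_in_subtopology)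
  qed
qed (auto simp: shift_def add.assoc)

lemma subst_orbit_dense:
  fixes \<theta> :: "'a::finite \<Rightarrow> 'a list"
  assumes cl: "constant_length L \<theta>" and prim: "primitive_subst \<theta>"
    and x: "x \<in> subst_shift_space \<theta>"
  shows "subst_shift_space \<theta> \<subseteq> subst_topology \<theta> closure_of range (\<lambda>t. shift t x)"
proof
  fix y assume y: "y \<in> subst_shift_space \<theta>"
  have "\<exists>z. z \<in> range (\<lambda>t. shift t x) \<and> z \<in> U" if "y \<in> U" "openin (subst_topology \<theta>) U" for U
  proof -
    obtain V where V: "openin full_shift V" "U = V \<inter> subst_shift_space \<theta>"
      using \<open>openin (subst_topology \<theta>) U\<close> unfolding subst_topology_def openin_subtopology by blast
    obtain N where "{z. \<forall>j::int. \<bar>j\<bar> \<le> N \<longrightarrow> z j = y j} \<subseteq> V"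
      using openin_full_shift_imp_cylinder[OF V(1), of y] V(2) \<open>y \<in> U\<close> by blast
    moreover obtain t where "\<forall>j. \<bar>j\<bar> \<le> N \<longrightarrow> shift t x j = y j"
      using orbit_meets_cylinder[OF cl prim x y] by blast
    ultimately have "shift t x \<in> U" using V(2) shift_in_space[OF x] by blast
    then show ?thesis by blast
  qed
  with y show "y \<in> subst_topology \<theta> closure_of range (\<lambda>t. shift t x)"
    unfolding in_closure_of by simp
qed

text \<open>Translations along the ray spread the bounded gaps between differences to the whole line
  in the limit \<open>s\<close>; every \<open>p\<close> then inherits a difference near 0.\<close>

lemma subst_ellis_separates:
  fixes \<theta> :: "'a::finite \<Rightarrow> 'a list"
  assumes bij: "bijective_subst L \<theta>" and aper: "aperiodic_subst \<theta>"
    and v: "v \<in> subst_shift_space \<theta>" and w: "w \<in> subst_shift_space \<theta>" and "v \<noteq> w"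
  shows "\<exists>s\<in>ellis_semigroup (subst_topology \<theta>) shift.
    \<forall>p\<in>ellis_semigroup (subst_topology \<theta>) shift. p (s v) \<noteq> p (s w)"
proof -
  interpret compact_flow "subst_topology \<theta>" shift by (rule compact_flow_subst)
  obtain \<epsilon> N c where \<epsilon>: "\<epsilon> = 1 \<or> \<epsilon> = (-1::int)"
    and diff: "\<And>n. \<epsilon> * n \<ge> c \<Longrightarrow> \<exists>j. \<bar>j\<bar> \<le> N \<and> v (n + j) \<noteq> w (n + j)"
    using differences_syndetic[OF bij aper v w \<open>v \<noteq> w\<close>] by blast
  \<comment> \<open>The bound \<open>N\<close> makes this a finite union of closed conditions, hence
    closed.\<close>
  define D where "D a b n = {q \<in> topspace T. \<exists>j. \<bar>j\<bar> \<le> N \<and> q a (n + j) \<noteq> q b (n + j)}"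
    for a b :: "int \<Rightarrow> 'a" and n
  have closed_D: "closedin T (D a b n)" if "a \<in> S" "b \<in> S" for a b n
  proof -
    have "closedin T {q \<in> topspace T. (q a i, q b i) \<in> - Id}" for i
    proof (rule closedin_continuous_map_preimage)
      have "continuous_map T (discrete_topology UNIV) (\<lambda>q. q x i)" if "x \<in> S" for x
        using continuous_map_compose[OF continuous_eval[OF that] continuous_coordinate[of \<theta> i]]
        by (simp add: comp_def)
      with \<open>a \<in> S\<close> \<open>b \<in> S\<close>
      have "continuous_map T (prod_topology (discrete_topology UNIV) (discrete_topology UNIV)) (\<lambda>q. (q a i, q b i))"
        by (intro continuous_map_pairedI)
      then show "continuous_map T (discrete_topology UNIV) (\<lambda>q. (q a i, q b i))"
        by (simp flip: prod_topology_discrete_topology)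
    qed simp
    then have "closedin T (\<Union>j\<in>{-N..N}. {q \<in> topspace T. (q a (n + j), q b (n + j)) \<in> - Id})"
      by (intro closedin_Union) auto
    moreover have "(\<Union>j\<in>{-N..N}. {q \<in> topspace T. (q a (n + j), q b (n + j)) \<in> - Id}) = D a b n"
    proof -
      have "{-N..N} = {j. \<bar>j\<bar> \<le> N}" by auto
      then show ?thesis unfolding D_def by blast
    qed
    ultimately show ?thesis by simp
  qed
  \<comment> \<open>The translation by \<open>\<epsilon> * int m\<close> lies in \<open>K m\<close>,
    as it moves the end of the ray from \<open>c\<close> to \<open>c - int m\<close>. The sets
    decrease, and a common point meets the condition at every \<open>n\<close>.\<close>
  define K where "K m = E \<inter> (\<Inter>n\<in>{n. \<epsilon> * n \<ge> c - int m}. D v w n)" for m :: nat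
  have "\<Inter>(range K) \<noteq> {}"
  proof (rule compact_space_imp_nest[OF compact_T])
    show "closedin T (K m)" for m
    proof (cases "{n. \<epsilon> * n \<ge> c - int m} = {}")
      case True
      then show ?thesis unfolding K_def using closedin_ellis by simp
    next
      case False
      moreover have "closedin T (D v w n)" for n using closed_D v w by simp
      ultimately show ?thesis unfolding K_def
        by (intro closedin_Int closedin_ellis closedin_Inter) blast+
    qed
    show "K m \<noteq> {}" for m
    proof -
      have "act (\<epsilon> * int m) \<in> D v w n" if "\<epsilon> * n \<ge> c - int m" for n
      proof -
        have "\<epsilon> * (n + \<epsilon> * int m) \<ge> c" using that \<epsilon> by auto
        then obtain j where "\<bar>j\<bar> \<le> N" "v (n + \<epsilon> * int m + j) \<noteq> w (n + \<epsilon> * int m + j)"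
          using diff by blast
        then have "\<bar>j\<bar> \<le> N \<and> act (\<epsilon> * int m) v (n + j) \<noteq> act (\<epsilon> * int m) w (n + j)"
          using v w by (simp add: shift_def algebra_simps)
        then show ?thesis unfolding D_def using act_in_topspace by blast
      qed
      then have "act (\<epsilon> * int m) \<in> K m" unfolding K_def using act_in_ellis by blast
      then show ?thesis by blast
    qed
    show "decseq K" unfolding decseq_def K_def by force
  qed
  then obtain s where s: "\<And>m. s \<in> K m" by blast
  have sE: "s \<in> E" using s[of 0] by (simp add: K_def)
  have sn: "s \<in> D v w n" for n
    using s[of "nat (c - \<epsilon> * n)"] unfolding K_def by auto
  have "p (s v) \<noteq> p (s w)" if "p \<in> E" for p
  proof -
    have S: "s v \<in> S" "s w \<in> S" using ellis_closed[OF sE] v w by auto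
    \<comment> \<open>For the translation by \<open>t\<close> this amounts to
      \<open>s \<in> D v w t\<close>; being closed, the condition reaches every
      \<open>p\<close>.\<close>
    have "p \<in> D (s v) (s w) 0"
      using \<open>p \<in> E\<close>
    proof (rule ellis_induct)
      show "act t \<in> D (s v) (s w) 0" for t
      proof -
        obtain j where "\<bar>j\<bar> \<le> N" "s v (t + j) \<noteq> s w (t + j)" using sn[of t] unfolding D_def by blast
        then have "\<bar>j\<bar> \<le> N \<and> act t (s v) (0 + j) \<noteq> act t (s w) (0 + j)"
          using S by (simp add: shift_def add.commute)
        then show ?thesis unfolding D_def using act_in_topspace by blast
      qed
      have "{p \<in> topspace T. p \<in> D (s v) (s w) 0} = D (s v) (s w) 0"
        unfolding D_def by blast
      then show "closedin T {p \<in> topspace T. p \<in> D (s v) (s w) 0}" using closed_D[OF S] by simp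
    qed
    then show ?thesis unfolding D_def by auto
  qed
  with sE show ?thesis by blast
qed

theorem corollary5p11:
  fixes \<theta> :: "'a::finite \<Rightarrow> 'a list" and L :: nat
  assumes "bijective_subst L \<theta>"
    and "primitive_subst \<theta>"
    and "aperiodic_subst \<theta>"
  shows "semi_regular (subst_topology \<theta>) shift"
proof -
  interpret compact_flow "subst_topology \<theta>" shift by (rule compact_flow_subst)
  have cl: "constant_length L \<theta>" using assms(1) by (simp add: bijective_subst_def)
  show ?thesis
  proof (rule semi_regularI)
    show "S \<subseteq> subst_topology \<theta> closure_of range (\<lambda>t. shift t x)" if "x \<in> S" for x
      using subst_orbit_dense[OF cl assms(2)] that by simp
    show "\<exists>s\<in>E. \<forall>p\<in>E. p (s v) \<noteq> p (s w)" if "v \<in> S" "w \<in> S" "v \<noteq> w" for v w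
      using subst_ellis_separates[OF assms(1,3)] that by simp
  qed
qed

end
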